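(* Let $S=\sum_{n\ge0}P_nS_n$ be an $\mathbb H^{r\times s}$-valued Schur multiplier. Then for every $u\in\mathbb H^s$ the function $R_0(Su)=\sum_{n\ge0}P_nS_{n+1}u$ belongs to $\mathcal H(S)$ and $$\|R_0(Su)\|_{\mathcal H(S)}^2\le u^*u-(S(0)u)^*(S(0)u).$$
   Context: For $m\ge0$, $T^m_j=\frac{2(m-j+1)}{(m+1)(m+2)}$, $c_m=\sum_{j=0}^m(-1)^jT^m_j$, $P_m(x)=\frac1{c_m}\sum_{j=0}^mT^m_jx^{m-j}\overline{x}^{\,j}$. $\mathcal E=\{x\in\mathbb H:9x_0^2+x_1^2+x_2^2+x_3^2<1\}$. $\odot$ is the Cauchy–Kovalevskaya product, with $P_n\odot S=\sum_mP_{n+m}S_m$. An $\mathbb H^{r\times s}$-valued hyperholomorphic $S$ on $\mathcal E$ is a Schur multiplier if $K_S(x,y)=\sum_{n\ge0}\big(P_n(x)\overline{P_n(y)}I_r-(P_n\odot S)(x)((P_n\odot S)(y))^*\big)$ is positive definite on $\mathcal E$. $\mathcal H(S)$ is the reproducing kernel Hilbert space of $\mathbb H^r$-valued functions with reproducing kernel $K_S$. $R_0\big(\sum_nP_nf_n\big)=\sum_nP_nf_{n+1}$. *)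

theory Defs
  imports "HOL-Analysis.Analysis"
begin

text \<open>A quaternion x0 + x1 i + x2 j + x3 k is encoded (Cayley--Dickson) as the pair
  (x0 + x1 i, x2 + x3 i) of complex numbers, i.e. q = a + b j.  Addition, real scaling,
  norm (= quaternionic modulus) and topology are those of the product type.\<close>

type_synonym quat = "complex \<times> complex"

definition qmul :: "quat \<Rightarrow> quat \<Rightarrow> quat" where
  "qmul p q = (fst p * fst q - snd p * cnj (snd q), fst p * snd q + snd p * cnj (fst q))"

definition qcnj :: "quat \<Rightarrow> quat" where
  "qcnj q = (cnj (fst q), - snd q)"

primrec qpow :: "quat \<Rightarrow> nat \<Rightarrow> quat" where
  "qpow q 0 = (1, 0)"
| "qpow q (Suc n) = qmul (qpow q n) q"

definition q0 :: "quat \<Rightarrow> real" where "q0 q = Re (fst q)"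
definition q1 :: "quat \<Rightarrow> real" where "q1 q = Im (fst q)"
definition q2 :: "quat \<Rightarrow> real" where "q2 q = Re (snd q)"
definition q3 :: "quat \<Rightarrow> real" where "q3 q = Im (snd q)"

definition qnonneg_real :: "quat \<Rightarrow> bool" where
  "qnonneg_real q \<longleftrightarrow> q1 q = 0 \<and> q2 q = 0 \<and> q3 q = 0 \<and> q0 q \<ge> 0"

definition Tcoef :: "nat \<Rightarrow> nat \<Rightarrow> real" where
  "Tcoef m j = 2 * (real m - real j + 1) / ((real m + 1) * (real m + 2))"

definition ccoef :: "nat \<Rightarrow> real" where
  "ccoef m = (\<Sum>j\<le>m. (-1) ^ j * Tcoef m j)"

definition Ppoly :: "nat \<Rightarrow> quat \<Rightarrow> quat" where
  "Ppoly m x = (1 / ccoef m) *\<^sub>R (\<Sum>j\<le>m. Tcoef m j *\<^sub>R qmul (qpow x (m - j)) (qpow (qcnj x) j))"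

definition Ell :: "quat set" where
  "Ell = {x. 9 * (q0 x)\<^sup>2 + (q1 x)\<^sup>2 + (q2 x)\<^sup>2 + (q3 x)\<^sup>2 < 1}"

text \<open>An H^{r x s}-valued function S = sum_n P_n S_n is given by its coefficient sequence
  Sc :: nat => (row index => column index => quat); only entries i < r, k < s matter.\<close>

definition Sval :: "(nat \<Rightarrow> nat \<Rightarrow> nat \<Rightarrow> quat) \<Rightarrow> quat \<Rightarrow> nat \<Rightarrow> nat \<Rightarrow> quat" where
  "Sval Sc x i k = (\<Sum>n. qmul (Ppoly n x) (Sc n i k))"

definition CKP :: "(nat \<Rightarrow> nat \<Rightarrow> nat \<Rightarrow> quat) \<Rightarrow> nat \<Rightarrow> quat \<Rightarrow> nat \<Rightarrow> nat \<Rightarrow> quat" where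
  "CKP Sc n x i k = (\<Sum>m. qmul (Ppoly (n + m) x) (Sc m i k))"

definition Kterm :: "nat \<Rightarrow> (nat \<Rightarrow> nat \<Rightarrow> nat \<Rightarrow> quat) \<Rightarrow> nat \<Rightarrow> quat \<Rightarrow> quat \<Rightarrow> nat \<Rightarrow> nat \<Rightarrow> quat" where
  "Kterm s Sc n x y i j =
     (if i = j then qmul (Ppoly n x) (qcnj (Ppoly n y)) else 0)
     - (\<Sum>k<s. qmul (CKP Sc n x i k) (qcnj (CKP Sc n y j k)))"

definition KS :: "nat \<Rightarrow> (nat \<Rightarrow> nat \<Rightarrow> nat \<Rightarrow> quat) \<Rightarrow> quat \<Rightarrow> quat \<Rightarrow> nat \<Rightarrow> nat \<Rightarrow> quat" where
  "KS s Sc x y i j = (\<Sum>n. Kterm s Sc n x y i j)"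

definition pos_kernel :: "nat \<Rightarrow> (quat \<Rightarrow> quat \<Rightarrow> nat \<Rightarrow> nat \<Rightarrow> quat) \<Rightarrow> bool" where
  "pos_kernel r K \<longleftrightarrow>
     (\<forall>N (pts :: nat \<Rightarrow> quat) (cs :: nat \<Rightarrow> nat \<Rightarrow> quat). (\<forall>a<N. pts a \<in> Ell) \<longrightarrow>
        qnonneg_real (\<Sum>a<N. \<Sum>b<N. \<Sum>i<r. \<Sum>j<r.
            qmul (qcnj (cs a i)) (qmul (K (pts a) (pts b) i j) (cs b j))))"

text \<open>Schur multiplier: S = sum_n P_n S_n is hyperholomorphic on the ellipsoid (its defining
  series converges there), the series defining P_n \<odot> S and K_S converge on the
  ellipsoid, and K_S is positive definite there.\<close>
definition schur_multiplier :: "nat \<Rightarrow> nat \<Rightarrow> (nat \<Rightarrow> nat \<Rightarrow> nat \<Rightarrow> quat) \<Rightarrow> bool" where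
  "schur_multiplier r s Sc \<longleftrightarrow>
     (\<forall>x\<in>Ell. \<forall>i<r. \<forall>k<s. summable (\<lambda>n. qmul (Ppoly n x) (Sc n i k))) \<and>
     (\<forall>x\<in>Ell. \<forall>n. \<forall>i<r. \<forall>k<s. summable (\<lambda>m. qmul (Ppoly (n + m) x) (Sc m i k))) \<and>
     (\<forall>x\<in>Ell. \<forall>y\<in>Ell. \<forall>i<r. \<forall>j<r. summable (\<lambda>n. Kterm s Sc n x y i j)) \<and>
     pos_kernel r (KS s Sc)"

text \<open>Functions E -> H^r are represented as quat => nat => quat vanishing off
  Ell x {..<r}.  The space is a right quaternionic Hilbert space whose inner product
  ip is right linear in the first argument, Hermitian, positive definite and complete,
  contains the kernel sections K(.,y)c, and satisfies <f, K(.,y)c> = c^* f(y).\<close>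

definition kfun :: "nat \<Rightarrow> (quat \<Rightarrow> quat \<Rightarrow> nat \<Rightarrow> nat \<Rightarrow> quat) \<Rightarrow> quat \<Rightarrow> (nat \<Rightarrow> quat)
                     \<Rightarrow> quat \<Rightarrow> nat \<Rightarrow> quat" where
  "kfun r K y c = (\<lambda>x i. if x \<in> Ell \<and> i < r then (\<Sum>j<r. qmul (K x y i j) (c j)) else 0)"

definition ipnorm :: "((quat \<Rightarrow> nat \<Rightarrow> quat) \<Rightarrow> (quat \<Rightarrow> nat \<Rightarrow> quat) \<Rightarrow> quat)
                      \<Rightarrow> (quat \<Rightarrow> nat \<Rightarrow> quat) \<Rightarrow> real" where
  "ipnorm ip f = sqrt (q0 (ip f f))"

definition is_RKHS :: "nat \<Rightarrow> (quat \<Rightarrow> quat \<Rightarrow> nat \<Rightarrow> nat \<Rightarrow> quat) \<Rightarrow> (quat \<Rightarrow> nat \<Rightarrow> quat) set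
                       \<Rightarrow> ((quat \<Rightarrow> nat \<Rightarrow> quat) \<Rightarrow> (quat \<Rightarrow> nat \<Rightarrow> quat) \<Rightarrow> quat) \<Rightarrow> bool" where
  "is_RKHS r K V ip \<longleftrightarrow>
     (\<forall>f\<in>V. \<forall>x i. (x \<notin> Ell \<or> r \<le> i) \<longrightarrow> f x i = 0) \<and>
     (\<lambda>x i. 0) \<in> V \<and>
     (\<forall>f\<in>V. \<forall>g\<in>V. (\<lambda>x i. f x i + g x i) \<in> V) \<and>
     (\<forall>f\<in>V. \<forall>a. (\<lambda>x i. qmul (f x i) a) \<in> V) \<and>
     (\<forall>f\<in>V. \<forall>g\<in>V. \<forall>h\<in>V. ip (\<lambda>x i. f x i + g x i) h = ip f h + ip g h) \<and>
     (\<forall>f\<in>V. \<forall>g\<in>V. \<forall>a. ip (\<lambda>x i. qmul (f x i) a) g = qmul (ip f g) a) \<and>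
     (\<forall>f\<in>V. \<forall>g\<in>V. ip g f = qcnj (ip f g)) \<and>
     (\<forall>f\<in>V. qnonneg_real (ip f f)) \<and>
     (\<forall>f\<in>V. ip f f = 0 \<longrightarrow> f = (\<lambda>x i. 0)) \<and>
     (\<forall>F. (\<forall>n. F n \<in> V) \<longrightarrow>
          (\<forall>e>0. \<exists>M. \<forall>m\<ge>M. \<forall>n\<ge>M. ipnorm ip (\<lambda>x i. F m x i - F n x i) < e) \<longrightarrow>
          (\<exists>f\<in>V. (\<lambda>n. ipnorm ip (\<lambda>x i. F n x i - f x i)) \<longlonglongrightarrow> 0)) \<and>
     (\<forall>y\<in>Ell. \<forall>c. kfun r K y c \<in> V) \<and>
     (\<forall>f\<in>V. \<forall>y\<in>Ell. \<forall>c. ip f (kfun r K y c) = (\<Sum>i<r. qmul (qcnj (c i)) (f y i)))"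

definition R0Su :: "nat \<Rightarrow> nat \<Rightarrow> (nat \<Rightarrow> nat \<Rightarrow> nat \<Rightarrow> quat) \<Rightarrow> (nat \<Rightarrow> quat) \<Rightarrow> quat \<Rightarrow> nat \<Rightarrow> quat" where
  "R0Su r s Sc u = (\<lambda>x i. if x \<in> Ell \<and> i < r
       then (\<Sum>n. qmul (Ppoly n x) (\<Sum>k<s. qmul (Sc (Suc n) i k) (u k))) else 0)"

end

theory Submission
  imports Defs "HOL-Computational_Algebra.Polynomial"
begin

text \<open>
  In the Hardy-type space of series with square summable coefficients, the kernel section at
  \<open>x\<close> has coefficients \<open>qcnj (P_n x)\<close>, and the adjoint of multiplication by \<open>S\<close> acts on
  coefficients as the Toeplitz operator \<open>p \<mapsto> (\<Sum>m. S_m^* p_(n+m))_n\<close>.  Positivity of \<open>K_S\<close> says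
  that this operator contracts finite combinations of kernel sections.  On the imaginary axis
  \<open>P_n\<close> is the power \<open>x^n\<close>, so every finitely supported sequence is a limit of such combinations and
  all finite Toeplitz sections are contractions.  Prefixing a sequence \<open>p\<close> by a free entry \<open>v\<close>
  gives \<open>|S_0^* v + G p|^2 \<le> |v|^2 + D p\<close>, where \<open>G p = (\<Sum>m. S_(m+1)^* p_m)\<close> and \<open>D\<close> is the
  quadratic form of \<open>K_S\<close>.  Hence \<open>(S_0^*, G)\<close> is a row contraction for \<open>D\<close>; taking adjoints,
  \<open>\<langle>u, G p\<rangle>^2 \<le> (|u|^2 - |S_0 u|^2) D p\<close>.  The left side is the functional induced by
  \<open>R_0 (S u)\<close>, and the claim is the Riesz representation of this functional in \<open>H(S)\<close>.
\<close>

section \<open>Quaternion algebra on Cayley-Dickson pairs\<close>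

lemma qnorm_sq: "(norm (p::quat))\<^sup>2 = (q0 p)\<^sup>2 + (q1 p)\<^sup>2 + (q2 p)\<^sup>2 + (q3 p)\<^sup>2"
  by (simp add: norm_prod_def q0_def q1_def q2_def q3_def cmod_power2)

lemma norm_qmul: "norm (qmul p q) = norm p * norm q"
proof -
  have "(norm (qmul p q))\<^sup>2 = (norm p * norm q)\<^sup>2"
    by (simp add: qnorm_sq power_mult_distrib q0_def q1_def q2_def q3_def qmul_def)
      (simp add: power2_eq_square algebra_simps)
  then show ?thesis by simp
qed

lemma norm_qcnj: "norm (qcnj p) = norm p"
  by (simp add: norm_prod_def qcnj_def)

lemma bounded_bilinear_qmul: "bounded_bilinear qmul"
proof (unfold_locales, goal_cases)
  case (5)
  show ?case by (intro exI[of _ 1]) (simp add: norm_qmul)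
qed (auto simp: qmul_def algebra_simps scaleR_conv_of_real)

lemma bounded_linear_qcnj: "bounded_linear qcnj"
  by (rule bounded_linear_intro[of _ 1]) (auto simp: norm_qcnj, auto simp: qcnj_def)

interpretation qmul_lin: bounded_bilinear qmul by (rule bounded_bilinear_qmul)

lemma qmul_assoc: "qmul (qmul p q) t = qmul p (qmul q t)"
  by (simp add: qmul_def algebra_simps)

lemma qcnj_qmul: "qcnj (qmul p q) = qmul (qcnj q) (qcnj p)"
  by (simp add: qmul_def qcnj_def algebra_simps)

lemma qcnj_qcnj [simp]: "qcnj (qcnj p) = p"
  by (simp add: qcnj_def)

lemma qmul_one [simp]: "qmul (1, 0) p = p" "qmul p (1, 0) = p"
  by (simp_all add: qmul_def)

lemma qmul_of_real: "qmul p (complex_of_real t, 0) = t *\<^sub>R p"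
  by (simp add: qmul_def scaleR_prod_def prod_eq_iff scaleR_conv_of_real)

text \<open>Allows the estimates to be carried out with the real inner product of the product type,
  which is the real part of the quaternionic pairing.\<close>

lemma q0_qcnj_qmul: "q0 (qmul (qcnj c) d) = inner c d"
  by (simp add: qmul_def qcnj_def q0_def inner_prod_def inner_complex_def)

lemma inner_qmul_left: "inner c (qmul p d) = inner (qmul (qcnj p) c) d"
  by (simp add: qmul_def qcnj_def inner_prod_def inner_complex_def algebra_simps)

lemma bounded_linear_q0: "bounded_linear q0"
  unfolding q0_def by (intro bounded_linear_compose[OF bounded_linear_Re bounded_linear_fst])


lemma norm_qpow: "norm (qpow p n) = norm p ^ n"
proof (induction n)
  case 0
  show ?case by (simp add: norm_prod_def)
qed (simp add: norm_qmul)

lemma qpow_add: "qpow p (m + n) = qmul (qpow p m) (qpow p n)"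
  by (induction n) (simp_all add: qmul_assoc)

lemma qpow_scaleR: "qpow (t *\<^sub>R p) n = t ^ n *\<^sub>R qpow p n"
  by (induction n) (simp_all add: qmul_lin.scaleR_left qmul_lin.scaleR_right)

lemma qmul_qcnj_self: "qmul (qcnj p) (qmul p d) = (norm p)\<^sup>2 *\<^sub>R d"
proof -
  have "qmul (qcnj p) p = (complex_of_real ((norm p)\<^sup>2), 0)"
    by (simp add: qmul_def qcnj_def qnorm_sq q0_def q1_def q2_def q3_def prod_eq_iff complex_eq_iff)
       (simp add: power2_eq_square)
  then show ?thesis
    by (simp add: qmul_assoc[symmetric]) (simp add: qmul_def prod_eq_iff scaleR_conv_of_real)
qed

section \<open>Normalizing constants and size of the polynomials\<close>

lemma sum_alternating_descending:
  "(\<Sum>j\<le>m. (-1) ^ j * (real m - real j + 1)) = (2 * real m + 3 + (-1) ^ m) / 4"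
proof (induction m)
  case (Suc m)
  \<comment> \<open>Splitting off j = 0 leaves the negated sum for m.\<close>
  have "(\<Sum>j\<le>Suc m. (-1) ^ j * (real (Suc m) - real j + 1))
      = real m + 2 - (\<Sum>j\<le>m. (-1) ^ j * (real m - real j + 1))"
    by (subst sum.atMost_Suc_shift) (simp add: sum_negf)
  then show ?case unfolding Suc by (simp add: field_simps)
qed simp

text \<open>In closed form \<open>ccoef m\<close> is (2m + 3 + (-1)^m) / (2(m + 1)(m + 2)). The
  cruder bound is enough: dividing by \<open>ccoef m\<close> then costs only a polynomial
  factor.\<close>

lemma ccoef_ge: "ccoef m \<ge> 1 / (real m + 2)"
proof -
  have "ccoef m = 2 * (\<Sum>j\<le>m. (-1) ^ j * (real m - real j + 1)) / ((real m + 1) * (real m + 2))"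
    unfolding ccoef_def Tcoef_def by (simp add: sum_distrib_left sum_divide_distrib algebra_simps)
  also have "\<dots> = (2 * real m + 3 + (-1) ^ m) / (2 * ((real m + 1) * (real m + 2)))"
    unfolding sum_alternating_descending by (simp add: divide_simps) (simp add: algebra_simps)
  also have "\<dots> \<ge> (2 * (real m + 1)) / (2 * ((real m + 1) * (real m + 2)))"
  proof (rule divide_right_mono)
    have "(-1::real) ^ m \<ge> -1" by (cases "even m") auto
    then show "2 * (real m + 1) \<le> 2 * real m + 3 + (- 1) ^ m" by simp
  qed simp
  also have "(2 * (real m + 1)) / (2 * ((real m + 1) * (real m + 2))) = 1 / (real m + 2)"
    by (simp add: divide_simps)
  finally show ?thesis .
qed

lemma ccoef_pos: "ccoef m > 0"
  using ccoef_ge[of m] by (smt (verit) divide_pos_pos of_nat_0_le_iff)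

lemma Tcoef_bounds:
  assumes "j \<le> m"
  shows "0 \<le> Tcoef m j" "Tcoef m j \<le> 1"
proof -
  show "0 \<le> Tcoef m j" unfolding Tcoef_def using assms by simp
  have "2 * (real m - real j + 1) \<le> (real m + 1) * (real m + 2)"
    using mult_mono[of 2 "real m + 2" "real m - real j + 1" "real m + 1"] assms
    by (simp add: algebra_simps)
  then show "Tcoef m j \<le> 1" unfolding Tcoef_def by simp
qed

text \<open>Conjugation preserves the modulus, so each of the m + 1 summands has norm at most |x|^m;
  the factor 1 / \<open>ccoef m\<close> contributes at most m + 2.\<close>

lemma norm_Ppoly_le: "norm (Ppoly m x) \<le> (real m + 2)\<^sup>2 * norm x ^ m"
proof -
  have "norm (\<Sum>j\<le>m. Tcoef m j *\<^sub>R qmul (qpow x (m - j)) (qpow (qcnj x) j))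
     \<le> (\<Sum>j\<le>m. norm x ^ m)"
  proof (rule sum_norm_le)
    fix j assume "j \<in> {..m}"
    then have j: "j \<le> m" by simp
    then show "norm (Tcoef m j *\<^sub>R qmul (qpow x (m - j)) (qpow (qcnj x) j)) \<le> norm x ^ m"
      using Tcoef_bounds[OF j]
      by (simp add: norm_qmul norm_qpow norm_qcnj power_add[symmetric] mult_left_le_one_le)
  qed
  then have "norm (Ppoly m x) \<le> (1 / ccoef m) * ((real m + 1) * norm x ^ m)"
    unfolding Ppoly_def using ccoef_pos[of m] by (simp add: divide_right_mono add.commute)
  also have "\<dots> \<le> (real m + 2) * ((real m + 1) * norm x ^ m)"
    using ccoef_ge[of m] ccoef_pos[of m] by (intro mult_right_mono) (auto simp: field_simps)
  also have "\<dots> \<le> (real m + 2)\<^sup>2 * norm x ^ m"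
    unfolding power2_eq_square mult.assoc by (intro mult_left_mono mult_right_mono) auto
  finally show ?thesis .
qed

lemma Ell_norm_less_one: "x \<in> Ell \<Longrightarrow> norm x < 1"
proof -
  assume "x \<in> Ell"
  then have "(norm x)\<^sup>2 < 1\<^sup>2"
    unfolding Ell_def qnorm_sq by (simp, smt (verit) zero_le_power2)
  then show ?thesis by (rule power_less_imp_less_base) simp
qed

lemma Ppoly_geometric_bound:
  assumes "x \<in> Ell"
  obtains C \<rho> where "C \<ge> 0" "0 \<le> \<rho>" "\<rho> < 1" "\<And>n. norm (Ppoly n x) \<le> C * \<rho> ^ n"
proof -
  \<comment> \<open>Of the three factors \<open>\<rho> ^ n\<close> in \<open>norm x ^ n\<close>, two
    absorb the polynomial factor (n + 2)^2 and one remains as decay.\<close>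
  define \<rho> where "\<rho> = root 3 (norm x)"
  have r: "0 \<le> \<rho>" "\<rho> < 1" "\<rho> ^ 3 = norm x"
    using Ell_norm_less_one[OF assms] by (auto simp: \<rho>_def)
  have "(\<lambda>n. real n * \<rho> ^ n + 2 * \<rho> ^ n) \<longlonglongrightarrow> 0 + 2 * 0"
    using r by (intro tendsto_intros powser_times_n_limit_0 LIMSEQ_power_zero) auto
  then have "Bseq (\<lambda>n. real n * \<rho> ^ n + 2 * \<rho> ^ n)"
    by (intro convergent_imp_Bseq convergentI)
  then obtain B where B: "B > 0" "\<And>n. norm (real n * \<rho> ^ n + 2 * \<rho> ^ n) \<le> B"
    unfolding Bseq_def by auto
  have "norm (Ppoly n x) \<le> B\<^sup>2 * \<rho> ^ n" for n
  proof -
    have "norm (Ppoly n x) \<le> ((real n + 2) * \<rho> ^ n)\<^sup>2 * \<rho> ^ n"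
      using norm_Ppoly_le[of n x] unfolding r(3)[symmetric]
      by (simp add: power_mult_distrib power2_eq_square power3_eq_cube mult_ac)
    also have "\<dots> \<le> B\<^sup>2 * \<rho> ^ n"
      using B(2)[of n] r by (intro mult_right_mono power_mono) (auto simp: algebra_simps)
    finally show ?thesis .
  qed
  with r show ?thesis by (intro that[of "B\<^sup>2" \<rho>]) auto
qed

section \<open>The imaginary axis\<close>

definition iq :: quat where "iq = (\<i>, 0)"

lemma norm_iq [simp]: "norm iq = 1"
  by (simp add: iq_def norm_prod_def)

text \<open>On the imaginary axis conjugation is negation, so the j-th summand is x^m with weight
  (-1)^j \<open>Tcoef m j\<close>. The weights add up to \<open>ccoef m\<close>, which the
  normalization cancels.\<close>

lemma Ppoly_imaginary: "Ppoly m (t *\<^sub>R iq) = t ^ m *\<^sub>R qpow iq m"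
proof -
  have c: "qcnj (t *\<^sub>R iq) = (-1) *\<^sub>R (t *\<^sub>R iq)" by (simp add: iq_def qcnj_def)
  have "(\<Sum>j\<le>m. Tcoef m j *\<^sub>R qmul (qpow (t *\<^sub>R iq) (m - j)) (qpow (qcnj (t *\<^sub>R iq)) j))
     = (\<Sum>j\<le>m. ((-1) ^ j * Tcoef m j) *\<^sub>R qpow (t *\<^sub>R iq) m)"
    unfolding c qpow_scaleR[of "-1"]
    by (intro sum.cong refl) (simp add: qmul_lin.scaleR_right qpow_add[symmetric])
  also have "\<dots> = ccoef m *\<^sub>R qpow (t *\<^sub>R iq) m"
    by (simp add: ccoef_def scaleR_sum_left)
  finally show ?thesis unfolding Ppoly_def using ccoef_pos[of m] by (simp add: qpow_scaleR)
qed

lemma imaginary_in_Ell: "\<bar>t\<bar> < 1 \<Longrightarrow> t *\<^sub>R iq \<in> Ell"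
  by (simp add: Ell_def iq_def q0_def q1_def q2_def q3_def abs_square_less_1)

text \<open>The origin lies on the imaginary axis, so \<open>Ppoly n 0\<close> vanishes for n > 0
  and only the constant term survives.\<close>

lemma Sval_zero: "Sval Sc 0 i k = Sc 0 i k"
proof -
  have P: "Ppoly n 0 = (if n = 0 then (1, 0) else 0)" for n
    using Ppoly_imaginary[of n 0] by auto
  have "(\<lambda>n. qmul (Ppoly n 0) (Sc n i k)) = (\<lambda>n. if n = 0 then Sc 0 i k else 0)"
    by (auto simp: P qmul_lin.zero_left)
  then show ?thesis
    unfolding Sval_def using sums_unique[OF sums_single[of 0 "\<lambda>_. Sc 0 i k"]] by simp
qed

section \<open>The kernel in terms of coefficient sequences\<close>

text \<open>Coefficient sequence of the kernel combination \<open>\<Sum>a. k(-, pts a) (cs a)\<close>, and its image under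
  the adjoint of multiplication by \<open>S\<close>.\<close>

definition pvec :: "nat \<Rightarrow> (nat \<Rightarrow> quat) \<Rightarrow> (nat \<Rightarrow> nat \<Rightarrow> quat) \<Rightarrow> nat \<Rightarrow> nat \<Rightarrow> quat" where
  "pvec N pts cs n i = (\<Sum>a<N. qmul (qcnj (Ppoly n (pts a))) (cs a i))"

definition avec :: "nat \<Rightarrow> (nat \<Rightarrow> nat \<Rightarrow> nat \<Rightarrow> quat) \<Rightarrow> nat \<Rightarrow> (nat \<Rightarrow> quat) \<Rightarrow> (nat \<Rightarrow> nat \<Rightarrow> quat)
    \<Rightarrow> nat \<Rightarrow> nat \<Rightarrow> quat" where
  "avec r Sc N pts cs n k = (\<Sum>a<N. \<Sum>i<r. qmul (qcnj (CKP Sc n (pts a) i k)) (cs a i))"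

text \<open>In the space with reproducing kernel \<open>K\<close> this is the squared norm of the
  combination of kernel sections at \<open>pts a\<close> with coefficients
  \<open>cs a\<close>.\<close>

definition kform :: "nat \<Rightarrow> (quat \<Rightarrow> quat \<Rightarrow> nat \<Rightarrow> nat \<Rightarrow> quat) \<Rightarrow> nat \<Rightarrow> (nat \<Rightarrow> quat)
    \<Rightarrow> (nat \<Rightarrow> nat \<Rightarrow> quat) \<Rightarrow> real" where
  "kform r K N pts cs =
     (\<Sum>a<N. \<Sum>b<N. \<Sum>i<r. \<Sum>j<r. inner (cs a i) (qmul (K (pts a) (pts b) i j) (cs b j)))"

lemma kform_nonneg:
  assumes "pos_kernel r K" "\<And>a. a < N \<Longrightarrow> pts a \<in> Ell"
  shows "kform r K N pts cs \<ge> 0"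
proof -
  have "qnonneg_real (\<Sum>a<N. \<Sum>b<N. \<Sum>i<r. \<Sum>j<r.
            qmul (qcnj (cs a i)) (qmul (K (pts a) (pts b) i j) (cs b j)))"
    using assms unfolding pos_kernel_def by blast
  then show ?thesis
    unfolding qnonneg_real_def kform_def
    by (simp add: linear_sum[OF bounded_linear.linear[OF bounded_linear_q0]] q0_qcnj_qmul)
qed

text \<open>Each summand of the kernel is a difference of two factorized kernels, so its quadratic
  form is a difference of squared norms. Moving the left factors across the inner product produces
  \<open>pvec\<close> and \<open>avec\<close>.\<close>

lemma kform_Kterm:
  "kform r (Kterm s Sc n) N pts cs
     = (\<Sum>i<r. (norm (pvec N pts cs n i))\<^sup>2) - (\<Sum>k<s. (norm (avec r Sc N pts cs n k))\<^sup>2)"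
proof -
  let ?P = "\<lambda>a i. qmul (qcnj (Ppoly n (pts a))) (cs a i)"
  let ?A = "\<lambda>a i k. qmul (qcnj (CKP Sc n (pts a) i k)) (cs a i)"
  have kt: "inner (cs a i) (qmul (Kterm s Sc n (pts a) (pts b) i j) (cs b j))
      = (if i = j then inner (?P a i) (?P b i) else 0) - (\<Sum>k<s. inner (?A a i k) (?A b j k))" for a b i j
    unfolding Kterm_def
    by (simp add: qmul_lin.diff_left qmul_lin.sum_left inner_diff_right inner_sum_right
        qmul_assoc inner_qmul_left qcnj_qmul qmul_lin.zero_left
        linear_0[OF bounded_linear.linear[OF bounded_linear_qcnj]])
  have P: "(norm (pvec N pts cs n i))\<^sup>2 = (\<Sum>a<N. \<Sum>b<N. inner (?P a i) (?P b i))" for i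
    unfolding power2_norm_eq_inner pvec_def
    by (simp add: inner_sum_left inner_sum_right) (rule sum.swap)
  have A: "(norm (avec r Sc N pts cs n k))\<^sup>2
      = (\<Sum>a<N. \<Sum>b<N. \<Sum>i<r. \<Sum>j<r. inner (?A a i k) (?A b j k))" for k
  proof -
    have "(norm (avec r Sc N pts cs n k))\<^sup>2
        = (\<Sum>a<N. \<Sum>b<N. inner (\<Sum>i<r. ?A a i k) (\<Sum>j<r. ?A b j k))"
      unfolding power2_norm_eq_inner avec_def inner_sum_left[of _ "{..<N}"] inner_sum_right[of _ _ "{..<N}"]
      by (rule sum.swap)
    also have "\<dots> = (\<Sum>a<N. \<Sum>b<N. \<Sum>i<r. \<Sum>j<r. inner (?A a i k) (?A b j k))"
      unfolding inner_sum_left inner_sum_right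
      by (rule sum.cong[OF refl], rule sum.cong[OF refl], rule sum.swap)
    finally show ?thesis .
  qed
  have "(\<Sum>a<N. \<Sum>b<N. \<Sum>i<r. \<Sum>j<r. if i = j then inner (?P a i) (?P b i) else 0)
      = (\<Sum>i<r. (norm (pvec N pts cs n i))\<^sup>2)"
    unfolding P by (simp add: sum.swap[of _ "{..<r}" "{..<N}"])
  moreover have "(\<Sum>a<N. \<Sum>b<N. \<Sum>i<r. \<Sum>j<r. \<Sum>k<s. inner (?A a i k) (?A b j k))
      = (\<Sum>k<s. (norm (avec r Sc N pts cs n k))\<^sup>2)"
    unfolding A
    by (simp add: sum.swap[of _ "{..<s}" "{..<r}"] sum.swap[of _ "{..<s}" "{..<N}"])
  ultimately show ?thesis
    unfolding kform_def kt sum_subtractf by simp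
qed

lemma schur_multiplierD:
  assumes "schur_multiplier r s Sc"
  shows "x \<in> Ell \<Longrightarrow> i < r \<Longrightarrow> k < s \<Longrightarrow> summable (\<lambda>n. qmul (Ppoly n x) (Sc n i k))"
    and "x \<in> Ell \<Longrightarrow> i < r \<Longrightarrow> k < s \<Longrightarrow> summable (\<lambda>m. qmul (Ppoly (n + m) x) (Sc m i k))"
    and "x \<in> Ell \<Longrightarrow> y \<in> Ell \<Longrightarrow> i < r \<Longrightarrow> j < r \<Longrightarrow> summable (\<lambda>n. Kterm s Sc n x y i j)"
    and "pos_kernel r (KS s Sc)"
  using assms unfolding schur_multiplier_def by blast+

text \<open>The summability of \<open>Kterm\<close> concerns the difference as a whole. Its two
  halves are separated later, once \<open>pvec\<close> is known to be square summable.\<close>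

lemma kform_sums:
  assumes "schur_multiplier r s Sc" "\<And>a. a < N \<Longrightarrow> pts a \<in> Ell"
  shows "(\<lambda>n. (\<Sum>i<r. (norm (pvec N pts cs n i))\<^sup>2) - (\<Sum>k<s. (norm (avec r Sc N pts cs n k))\<^sup>2))
           sums kform r (KS s Sc) N pts cs"
proof -
  have "(\<lambda>n. kform r (Kterm s Sc n) N pts cs) sums kform r (KS s Sc) N pts cs"
    unfolding kform_def
  proof (intro sums_sum)
    fix a b i j assume *: "a \<in> {..<N}" "b \<in> {..<N}" "i \<in> {..<r}" "j \<in> {..<r}"
    have "bounded_linear (\<lambda>K. inner (cs a i) (qmul K (cs b j)))"
      by (rule bounded_linear_compose[OF bounded_linear_inner_right qmul_lin.bounded_linear_left])
    moreover have "(\<lambda>n. Kterm s Sc n (pts a) (pts b) i j) sums KS s Sc (pts a) (pts b) i j"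
      unfolding KS_def by (intro summable_sums schur_multiplierD(3)[OF assms(1)]) (use assms(2) * in auto)
    ultimately show "(\<lambda>n. inner (cs a i) (qmul (Kterm s Sc n (pts a) (pts b) i j) (cs b j)))
        sums inner (cs a i) (qmul (KS s Sc (pts a) (pts b) i j) (cs b j))"
      by (rule bounded_linear.sums)
  qed
  then show ?thesis unfolding kform_Kterm .
qed

text \<open>Expanding each \<open>CKP\<close> value by its series and collecting the points exhibits
  \<open>avec\<close> as an upper triangular Toeplitz operator, with the adjoint coefficients of S
  as entries, applied to \<open>pvec\<close>.\<close>

lemma avec_sums:
  assumes "schur_multiplier r s Sc" "\<And>a. a < N \<Longrightarrow> pts a \<in> Ell" "k < s"
  shows "(\<lambda>m. \<Sum>i<r. qmul (qcnj (Sc m i k)) (pvec N pts cs (n + m) i)) sums avec r Sc N pts cs n k"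
proof -
  have "(\<lambda>m. \<Sum>a<N. \<Sum>i<r. qmul (qcnj (qmul (Ppoly (n + m) (pts a)) (Sc m i k))) (cs a i))
      sums avec r Sc N pts cs n k"
    unfolding avec_def
  proof (intro sums_sum)
    fix a i assume *: "a \<in> {..<N}" "i \<in> {..<r}"
    have "bounded_linear (\<lambda>z. qmul (qcnj z) (cs a i))"
      by (rule bounded_linear_compose[OF qmul_lin.bounded_linear_left bounded_linear_qcnj])
    moreover have "(\<lambda>m. qmul (Ppoly (n + m) (pts a)) (Sc m i k)) sums CKP Sc n (pts a) i k"
      unfolding CKP_def by (intro summable_sums schur_multiplierD(2)[OF assms(1)]) (use assms(2,3) * in auto)
    ultimately show "(\<lambda>m. qmul (qcnj (qmul (Ppoly (n + m) (pts a)) (Sc m i k))) (cs a i))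
        sums qmul (qcnj (CKP Sc n (pts a) i k)) (cs a i)"
      by (rule bounded_linear.sums)
  qed
  moreover have "(\<Sum>a<N. \<Sum>i<r. qmul (qcnj (qmul (Ppoly (n + m) (pts a)) (Sc m i k))) (cs a i))
      = (\<Sum>i<r. qmul (qcnj (Sc m i k)) (pvec N pts cs (n + m) i))" for m
    unfolding pvec_def qmul_lin.sum_right
    by (subst sum.swap) (simp add: qcnj_qmul qmul_assoc)
  ultimately show ?thesis by simp
qed

text \<open>Every point contributes geometric decay; for finitely many points the largest ratio
  serves.\<close>

lemma pvec_summable:
  assumes "\<And>a. a < N \<Longrightarrow> pts a \<in> Ell"
  shows "summable (\<lambda>n. (norm (pvec N pts cs n i))\<^sup>2)"
proof -
  have "\<exists>C \<rho>. 0 \<le> \<rho> \<and> \<rho> < 1 \<and> C \<ge> 0 \<and> (\<forall>n. norm (pvec N pts cs n i) \<le> C * \<rho> ^ n)"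
    using assms
  proof (induction N)
    case 0
    show ?case by (rule exI[of _ 0], rule exI[of _ 0]) (simp add: pvec_def)
  next
    case (Suc N)
    then obtain C \<rho> where C: "0 \<le> \<rho>" "\<rho> < 1" "C \<ge> 0" "\<And>n. norm (pvec N pts cs n i) \<le> C * \<rho> ^ n"
      by auto
    obtain D \<sigma> where D: "D \<ge> 0" "0 \<le> \<sigma>" "\<sigma> < 1" "\<And>n. norm (Ppoly n (pts N)) \<le> D * \<sigma> ^ n"
      using Ppoly_geometric_bound[OF Suc.prems[of N]] by auto
    have "norm (pvec (Suc N) pts cs n i) \<le> (C + D * norm (cs N i)) * (max \<rho> \<sigma>) ^ n" for n
    proof -
      have "norm (pvec (Suc N) pts cs n i) \<le> C * \<rho> ^ n + (D * \<sigma> ^ n) * norm (cs N i)"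
        unfolding pvec_def sum.lessThan_Suc
        by (intro norm_triangle_le add_mono C(4)[unfolded pvec_def])
          (simp add: norm_qmul norm_qcnj D(4) mult_right_mono)
      also have "\<dots> \<le> C * (max \<rho> \<sigma>) ^ n + (D * (max \<rho> \<sigma>) ^ n) * norm (cs N i)"
        using C D by (intro add_mono mult_left_mono mult_right_mono power_mono) auto
      finally show ?thesis by (simp add: algebra_simps)
    qed
    then show ?case using C D by (intro exI[of _ "C + D * norm (cs N i)"] exI[of _ "max \<rho> \<sigma>"]) auto
  qed
  then obtain C \<rho> where C: "0 \<le> \<rho>" "\<rho> < 1" "\<And>n. norm (pvec N pts cs n i) \<le> C * \<rho> ^ n"
    by auto
  show ?thesis
  proof (rule summable_comparison_test'[of "\<lambda>n. C\<^sup>2 * (\<rho>\<^sup>2) ^ n"])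
    show "summable (\<lambda>n. C\<^sup>2 * (\<rho>\<^sup>2) ^ n)"
      using C by (intro summable_mult summable_geometric) (simp add: abs_square_less_1)
    show "norm ((norm (pvec N pts cs n i))\<^sup>2) \<le> C\<^sup>2 * (\<rho>\<^sup>2) ^ n" for n
      using power_mono[OF C(3)[of n], of 2]
      by (simp add: power_mult_distrib power2_eq_square mult_ac)
  qed
qed

text \<open>The squares of \<open>pvec\<close> are summable by themselves, so subtracting the series
  of differences isolates the squares of \<open>avec\<close>.\<close>

lemma avec_norm_sums:
  assumes "schur_multiplier r s Sc" "\<And>a. a < N \<Longrightarrow> pts a \<in> Ell"
  shows "(\<lambda>n. \<Sum>k<s. (norm (avec r Sc N pts cs n k))\<^sup>2)
     sums ((\<Sum>n. \<Sum>i<r. (norm (pvec N pts cs n i))\<^sup>2) - kform r (KS s Sc) N pts cs)"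
proof -
  have "summable (\<lambda>n. \<Sum>i<r. (norm (pvec N pts cs n i))\<^sup>2)"
    by (intro summable_sum pvec_summable assms(2))
  from sums_diff[OF summable_sums[OF this] kform_sums[where cs = cs and pts = pts and N = N, OF assms]]
  show ?thesis by simp
qed

text \<open>Positivity of the kernel enters here: the total for \<open>avec\<close> is the total for
  \<open>pvec\<close> minus a nonnegative form.\<close>

lemma avec_partial_le:
  assumes "schur_multiplier r s Sc" "\<And>a. a < N \<Longrightarrow> pts a \<in> Ell"
  shows "(\<Sum>n\<le>M. \<Sum>k<s. (norm (avec r Sc N pts cs n k))\<^sup>2)
       \<le> (\<Sum>n. \<Sum>i<r. (norm (pvec N pts cs n i))\<^sup>2)"
proof -
  note s = avec_norm_sums[where cs = cs and pts = pts and N = N, OF assms]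
  have "(\<Sum>n\<le>M. \<Sum>k<s. (norm (avec r Sc N pts cs n k))\<^sup>2)
      \<le> (\<Sum>n. \<Sum>k<s. (norm (avec r Sc N pts cs n k))\<^sup>2)"
    by (rule sum_le_suminf[OF sums_summable[OF s]]) (auto intro: sum_nonneg)
  then show ?thesis
    using sums_unique[OF s] kform_nonneg[where cs = cs and pts = pts and N = N, OF schur_multiplierD(4)[OF assms(1)] assms(2)]
    by simp
qed

section \<open>Approximation of finite sequences by kernel combinations\<close>

lemma vandermonde_dual:
  "\<exists>w :: nat \<Rightarrow> nat \<Rightarrow> real. \<forall>n\<le>N. \<forall>k\<le>N. (\<Sum>a\<le>N. w k a * real a ^ n) = (if k = n then 1 else 0)"
proof -
  \<comment> \<open>coefficients of the Lagrange basis polynomials at the nodes \<open>0, \<dots>, N\<close>\<close>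
  define L where "L a = (\<Prod>b\<in>{..N}-{a}. smult (1 / (real a - real b)) [:- real b, 1:])" for a
  have degL: "degree (L a) \<le> N" if "a \<le> N" for a
  proof -
    have "degree (L a) \<le> (\<Sum>b\<in>{..N}-{a}. degree (smult (1 / (real a - real b)) [:- real b, 1:]))"
      unfolding L_def by (rule degree_prod_sum_le[OF finite_Diff, OF finite_atMost, unfolded o_def])
    also have "\<dots> \<le> (\<Sum>b\<in>{..N}-{a}. 1)"
      by (intro sum_mono order_trans[OF degree_smult_le]) simp
    finally show ?thesis using that by simp
  qed
  have polyL: "poly (L a) (real b) = (if a = b then 1 else 0)" if "a \<le> N" "b \<le> N" for a b
  proof -
    have "poly (L a) (real b) = (\<Prod>c\<in>{..N}-{a}. (real b - real c) / (real a - real c))"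
      by (simp add: L_def poly_prod diff_divide_distrib)
    also have "\<dots> = (if a = b then 1 else 0)"
    proof (cases "a = b")
      case True
      then show ?thesis by (simp add: prod.neutral)
    next
      case False
      then show ?thesis using that by (simp add: prod_zero_iff)
    qed
    finally show ?thesis .
  qed
  have "(\<Sum>a\<le>N. coeff (L a) k * real a ^ n) = (if k = n then 1 else 0)" if n: "n \<le> N" for n k
  proof -
    define q where "q = (\<Sum>a\<le>N. smult (real a ^ n) (L a))"
    \<comment> \<open>Interpolation at N + 1 nodes reproduces polynomials of degree at most N, so
      the coefficients of the Lagrange basis form the inverse Vandermonde matrix.\<close>
    have "monom 1 n = q"
    proof (rule poly_eqI_degree[of "real ` {..N}"])
      show "poly (monom 1 n) x = poly q x" if "x \<in> real ` {..N}" for x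
      proof -
        obtain b where b: "b \<le> N" "x = real b" using \<open>x \<in> real ` {..N}\<close> by auto
        have "poly q x = (\<Sum>a\<le>N. if a = b then real a ^ n else 0)"
          unfolding q_def b(2) poly_sum using polyL[OF _ b(1)] by (intro sum.cong) auto
        then show ?thesis using b by (simp add: poly_monom)
      qed
      have card: "card (real ` {..N}) = Suc N" by (simp add: card_image)
      show "degree (monom (1::real) n) < card (real ` {..N})"
        using n by (simp add: card degree_monom_eq)
      have "degree q \<le> N" unfolding q_def
        by (intro degree_sum_le order_trans[OF degree_smult_le] degL) auto
      then show "degree q < card (real ` {..N})" by (simp add: card)
    qed
    then have "coeff (monom 1 n) k = coeff q k" by simp
    then show ?thesis by (auto simp: q_def coeff_sum mult.commute)
  qed
  then show ?thesis by (intro exI[of _ "\<lambda>k a. coeff (L a) k"]) simp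
qed

text \<open>Sampling at N + 1 imaginary points fixes the coefficients up to degree N; the tail is
  made small by shrinking the points towards the origin. The ratio 1/4 is chosen to beat the growth
  2^m of the coefficients of S.\<close>

lemma pvec_approx:
  assumes "\<epsilon> > 0"
  shows "\<exists>pts cs. (\<forall>a. a < Suc N \<longrightarrow> pts a \<in> Ell) \<and>
    (\<forall>n\<le>N. \<forall>i<r. pvec (Suc N) pts cs n i = q n i) \<and>
    (\<forall>n>N. \<forall>i<r. norm (pvec (Suc N) pts cs n i) \<le> \<epsilon> * (1/4) ^ n)"
proof -
  obtain w :: "nat \<Rightarrow> nat \<Rightarrow> real"
    where w: "\<And>n k. n \<le> N \<Longrightarrow> k \<le> N \<Longrightarrow> (\<Sum>a\<le>N. w k a * real a ^ n) = (if k = n then 1 else 0)"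
    using vandermonde_dual[of N] by blast
  define R where "R = real N + 1"
  define B where "B = (\<Sum>i<r. \<Sum>k\<le>N. (\<Sum>a\<le>N. \<bar>w k a\<bar>) * norm (q k i))"
  \<comment> \<open>The first bound keeps \<open>h * R\<close> at most 1/4, which puts the points in
    \<open>Ell\<close> and yields the geometric ratio. The second lets a single factor
    \<open>h\<close> pay for all constants and for \<epsilon>.\<close>
  define h where "h = min (1 / (4 * R)) (\<epsilon> / ((4 * R) ^ Suc N * (B + 1)))"
  have R: "R \<ge> 1" by (simp add: R_def)
  have B: "B \<ge> 0" unfolding B_def by (intro sum_nonneg mult_nonneg_nonneg) auto
  have h: "h > 0" "h * R \<le> 1/4" "h * ((4 * R) ^ Suc N * (B + 1)) \<le> \<epsilon>"
  proof -
    show "h > 0" unfolding h_def using R B assms by auto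
    have "h \<le> 1 / (4 * R)" by (simp add: h_def)
    then show "h * R \<le> 1/4" using R by (simp add: field_simps)
    have "h \<le> \<epsilon> / ((4 * R) ^ Suc N * (B + 1))" by (simp add: h_def)
    moreover have "(4 * R) ^ Suc N * (B + 1) > 0" using R B by (intro mult_pos_pos) auto
    ultimately show "h * ((4 * R) ^ Suc N * (B + 1)) \<le> \<epsilon>"
      by (simp only: pos_le_divide_eq)
  qed
  have h1: "h \<le> 1"
  proof -
    have "h * 1 \<le> h * R" using R h(1) by (intro mult_left_mono) auto
    then show ?thesis using h(2) by simp
  qed
  \<comment> \<open>Combinations at the points \<open>h a i\<close> that reproduce \<open>q\<close> exactly up to degree \<open>N\<close>; the later
    coefficients carry a spare factor of \<open>h\<close>.\<close>
  define pts where "pts a = (h * real a) *\<^sub>R iq" for a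
  define cs where "cs a i = (\<Sum>k\<le>N. (w k a / h ^ k) *\<^sub>R qmul (qpow iq k) (q k i))" for a i
  define X where "X n k i = qmul (qcnj (qpow iq n)) (qmul (qpow iq k) (q k i))" for n k i
  have X: "norm (X n k i) = norm (q k i)" "X n n i = q n i" for n k i
    by (simp_all add: X_def norm_qmul norm_qcnj norm_qpow qmul_qcnj_self)
  have qcs: "qcnj (t *\<^sub>R z) = t *\<^sub>R qcnj z" for t z by (simp add: qcnj_def)
  have p: "pvec (Suc N) pts cs n i
      = (\<Sum>k\<le>N. (h ^ n / h ^ k * (\<Sum>a\<le>N. w k a * real a ^ n)) *\<^sub>R X n k i)" for n i
  proof -
    have "pvec (Suc N) pts cs n i
        = (\<Sum>a\<le>N. \<Sum>k\<le>N. (h ^ n / h ^ k * (w k a * real a ^ n)) *\<^sub>R X n k i)"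
      unfolding pvec_def lessThan_Suc_atMost pts_def cs_def Ppoly_imaginary qcs X_def
        qmul_lin.scaleR_left qmul_lin.scaleR_right qmul_lin.sum_right scaleR_sum_right scaleR_scaleR
      by (intro sum.cong refl arg_cong2[where f = scaleR]) (simp add: power_mult_distrib)
    also have "\<dots> = (\<Sum>k\<le>N. (h ^ n / h ^ k * (\<Sum>a\<le>N. w k a * real a ^ n)) *\<^sub>R X n k i)"
      by (subst sum.swap) (simp add: scaleR_sum_left sum_distrib_left)
    finally show ?thesis .
  qed
  show ?thesis
  proof (intro exI[of _ pts] exI[of _ cs] conjI allI impI)
    fix a assume "a < Suc N"
    then have ha: "h * real a < h * R" using h(1) by (simp add: R_def)
    then have "\<bar>h * real a\<bar> < 1" using h(1,2) by (simp add: abs_mult) (use ha h(2) in linarith)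
    then show "pts a \<in> Ell" unfolding pts_def by (rule imaginary_in_Ell)
  next
    fix n i assume n: "n \<le> N"
    have "pvec (Suc N) pts cs n i = (\<Sum>k\<le>N. if k = n then q n i else 0)"
      unfolding p using h(1) by (intro sum.cong refl) (simp add: w[OF n] X(2))
    then show "pvec (Suc N) pts cs n i = q n i" using n by simp
  next
    fix n i assume n: "N < n" and i: "i < r"
    have "norm (pvec (Suc N) pts cs n i)
       \<le> (\<Sum>k\<le>N. (h ^ (n - N) * ((\<Sum>a\<le>N. \<bar>w k a\<bar>) * R ^ n)) * norm (q k i))"
      unfolding p
    proof (rule sum_norm_le)
      fix k assume k: "k \<in> {..N}"
      have "h ^ n / h ^ k = h ^ (n - k)" using k n h(1) by (simp add: power_diff)
      also have "\<dots> \<le> h ^ (n - N)" using k n h(1) h1 by (intro power_decreasing) auto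
      finally have 1: "h ^ n / h ^ k \<le> h ^ (n - N)" .
      have "\<bar>\<Sum>a\<le>N. w k a * real a ^ n\<bar> \<le> (\<Sum>a\<le>N. \<bar>w k a\<bar> * R ^ n)"
        by (rule order_trans[OF sum_abs], rule sum_mono)
          (auto simp: abs_mult R_def intro!: mult_left_mono power_mono)
      then have 2: "\<bar>\<Sum>a\<le>N. w k a * real a ^ n\<bar> \<le> (\<Sum>a\<le>N. \<bar>w k a\<bar>) * R ^ n"
        by (simp add: sum_distrib_right)
      show "norm ((h ^ n / h ^ k * (\<Sum>a\<le>N. w k a * real a ^ n)) *\<^sub>R X n k i)
          \<le> (h ^ (n - N) * ((\<Sum>a\<le>N. \<bar>w k a\<bar>) * R ^ n)) * norm (q k i)"
        unfolding norm_scaleR X(1) abs_mult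
        using h(1) R 1 2 by (intro mult_right_mono mult_mono) (auto intro!: mult_nonneg_nonneg sum_nonneg)
    qed
    also have "\<dots> = h ^ (n - N) * R ^ n * (\<Sum>k\<le>N. (\<Sum>a\<le>N. \<bar>w k a\<bar>) * norm (q k i))"
      by (simp add: sum_distrib_left mult_ac)
    also have "\<dots> \<le> h ^ (n - N) * R ^ n * (B + 1)"
    proof (rule mult_left_mono)
      have "(\<Sum>k\<le>N. (\<Sum>a\<le>N. \<bar>w k a\<bar>) * norm (q k i)) \<le> B"
        unfolding B_def using i
        by (intro member_le_sum[of i _ "\<lambda>i. \<Sum>k\<le>N. (\<Sum>a\<le>N. \<bar>w k a\<bar>) * norm (q k i)"])
          (auto intro!: sum_nonneg mult_nonneg_nonneg)
      then show "(\<Sum>k\<le>N. (\<Sum>a\<le>N. \<bar>w k a\<bar>) * norm (q k i)) \<le> B + 1" by simp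
      show "0 \<le> h ^ (n - N) * R ^ n" using h R by simp
    qed
    also have "h ^ (n - N) * R ^ n * (B + 1) \<le> \<epsilon> * (1/4) ^ n"
    proof -
      \<comment> \<open>There are l + 1 factors \<open>h\<close>: l of them pair with powers of
        \<open>R\<close> to give the ratio 1/4, and the remaining one absorbs the constants.\<close>
      obtain l where l: "n = Suc N + l" using n less_iff_Suc_add by auto
      have "h ^ (n - N) * R ^ n * (B + 1) = (h * R) ^ l * (h * R ^ Suc N * (B + 1))"
        unfolding l by (simp add: power_add power_mult_distrib)
      also have "\<dots> \<le> (1/4) ^ l * (h * R ^ Suc N * (B + 1))"
        using h(1,2) R B by (intro mult_right_mono power_mono) auto
      also have "\<dots> = (h * ((4 * R) ^ Suc N * (B + 1))) * (1/4) ^ n"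
        unfolding l power_add power_mult_distrib by (simp add: power_divide)
      also have "\<dots> \<le> \<epsilon> * (1/4) ^ n" using h(3) by (intro mult_right_mono) auto
      finally show ?thesis .
    qed
    finally show "norm (pvec (Suc N) pts cs n i) \<le> \<epsilon> * (1/4) ^ n" .
  qed
qed

section \<open>Contractivity of the finite Toeplitz sections\<close>

lemma coefficient_growth:
  assumes "schur_multiplier r s Sc"
  obtains C where "C \<ge> 0" "\<And>m i k. i < r \<Longrightarrow> k < s \<Longrightarrow> norm (Sc m i k) \<le> C * 2 ^ m"
proof -
  have "\<exists>C. \<forall>m. i < r \<longrightarrow> k < s \<longrightarrow> norm (Sc m i k) \<le> C * 2 ^ m" for i k
  proof (cases "i < r \<and> k < s")
    case True
    \<comment> \<open>At i/2 the polynomial \<open>Ppoly n\<close> has norm 2^(-n), so the bounded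
      terms of the convergent series give growth at most 2^n.\<close>
    have "(1/2) *\<^sub>R iq \<in> Ell" by (rule imaginary_in_Ell) simp
    then have "summable (\<lambda>n. qmul (Ppoly n ((1/2) *\<^sub>R iq)) (Sc n i k))"
      using schur_multiplierD(1)[OF assms] True by blast
    then have "Bseq (\<lambda>n. qmul (Ppoly n ((1/2) *\<^sub>R iq)) (Sc n i k))"
      by (intro convergent_imp_Bseq convergentI[OF summable_LIMSEQ_zero])
    then obtain K where "\<And>n. norm (qmul (Ppoly n ((1/2) *\<^sub>R iq)) (Sc n i k)) \<le> K"
      unfolding Bseq_def by auto
    then have "norm (Sc n i k) \<le> K * 2 ^ n" for n
      by (simp add: norm_qmul Ppoly_imaginary norm_qpow field_simps)
    then show ?thesis by blast
  qed auto
  then obtain C where C: "\<And>m i k. i < r \<Longrightarrow> k < s \<Longrightarrow> norm (Sc m i k) \<le> C i k * 2 ^ m"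
    by metis
  define D where "D = (\<Sum>i<r. \<Sum>k<s. \<bar>C i k\<bar>)"
  have "norm (Sc m i k) \<le> D * 2 ^ m" if "i < r" "k < s" for m i k
  proof -
    have "\<bar>C i k\<bar> \<le> (\<Sum>k<s. \<bar>C i k\<bar>)" using that by (intro member_le_sum) auto
    also have "\<dots> \<le> D" unfolding D_def using that
      by (intro member_le_sum[of i _ "\<lambda>i. \<Sum>k<s. \<bar>C i k\<bar>"]) (auto intro: sum_nonneg)
    finally have "C i k * 2 ^ m \<le> D * 2 ^ m" by (intro mult_right_mono) auto
    with C[OF that, of m] show ?thesis by (rule order_trans)
  qed
  moreover have "D \<ge> 0" unfolding D_def by (intro sum_nonneg) auto
  ultimately show ?thesis using that by blast
qed

text \<open>The adjoint Toeplitz operator on sequences supported in degrees \<open>\<le> N\<close>.\<close>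

definition toep :: "nat \<Rightarrow> (nat \<Rightarrow> nat \<Rightarrow> nat \<Rightarrow> quat) \<Rightarrow> nat \<Rightarrow> (nat \<Rightarrow> nat \<Rightarrow> quat) \<Rightarrow> nat \<Rightarrow> nat \<Rightarrow> quat" where
  "toep r Sc N q n k = (\<Sum>m\<in>{m. n + m \<le> N}. \<Sum>i<r. qmul (qcnj (Sc m i k)) (q (n + m) i))"

lemma finite_shifted: "finite {m. n + m \<le> (N::nat)}"
  by (rule finite_subset[of _ "{..N}"]) auto

text \<open>Kernel combinations that agree with \<open>q\<close> up to degree N and have tails
  tending to zero satisfy the inequality up to an error, by positivity of the kernel; the limit
  removes the error.\<close>

lemma toep_contraction:
  assumes S: "schur_multiplier r s Sc"
  shows "(\<Sum>n\<le>N. \<Sum>k<s. (norm (toep r Sc N q n k))\<^sup>2) \<le> (\<Sum>n\<le>N. \<Sum>i<r. (norm (q n i))\<^sup>2)"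
proof -
  obtain C where C: "C \<ge> 0" "\<And>m i k. i < r \<Longrightarrow> k < s \<Longrightarrow> norm (Sc m i k) \<le> C * 2 ^ m"
    using coefficient_growth[OF S] by blast
  define e where "e l = 1 / real (Suc l)" for l
  have e: "e l > 0" for l by (simp add: e_def)
  have e0: "e \<longlonglongrightarrow> 0"
    unfolding e_def using LIMSEQ_inverse_real_of_nat by (simp add: inverse_eq_divide)
  obtain pts cs where pts: "\<And>l a. a < Suc N \<Longrightarrow> pts l a \<in> Ell"
    and eq: "\<And>l n i. n \<le> N \<Longrightarrow> i < r \<Longrightarrow> pvec (Suc N) (pts l) (cs l) n i = q n i"
    and le: "\<And>l n i. n > N \<Longrightarrow> i < r \<Longrightarrow> norm (pvec (Suc N) (pts l) (cs l) n i) \<le> e l * (1/4) ^ n"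
    using pvec_approx[OF e] by metis
  let ?p = "\<lambda>l. pvec (Suc N) (pts l) (cs l)"
  let ?A = "\<lambda>l. avec r Sc (Suc N) (pts l) (cs l)"
  \<comment> \<open>The difference is the part of the series with n + m > N, where 2^m against
    (1/4)^m leaves a summable (1/2)^m and the factor \<open>e l\<close> tends to zero.\<close>
  have A_lim: "(\<lambda>l. ?A l n k) \<longlonglongrightarrow> toep r Sc N q n k" if k: "k < s" for n k
  proof (rule LIM_zero_cancel, rule Lim_null_comparison)
    show "(\<lambda>l. e l * (2 * real r * C)) \<longlonglongrightarrow> 0"
      using tendsto_mult_right[OF e0, of "2 * real r * C"] by simp
    show "\<forall>\<^sub>F l in sequentially. norm (?A l n k - toep r Sc N q n k) \<le> e l * (2 * real r * C)"
    proof (rule always_eventually, rule allI)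
      fix l
      let ?f = "\<lambda>m. \<Sum>i<r. qmul (qcnj (Sc m i k)) (?p l (n + m) i)"
      let ?g = "\<lambda>m. if m \<in> {m. n + m \<le> N} then ?f m else 0"
      have "?g sums (\<Sum>m\<in>{m. n + m \<le> N}. ?f m)"
        by (rule sums_If_finite_set[OF finite_shifted])
      also have "(\<Sum>m\<in>{m. n + m \<le> N}. ?f m) = toep r Sc N q n k"
        unfolding toep_def by (intro sum.cong refl) (simp add: eq)
      finally have d: "(\<lambda>m. ?f m - ?g m) sums (?A l n k - toep r Sc N q n k)"
        using avec_sums[where N = "Suc N" and pts = "pts l" and cs = "cs l" and n = n, OF S pts k] by (intro sums_diff) auto
      have bound: "norm (?f m - ?g m) \<le> e l * (real r * C) * (1/2) ^ m" for m
      proof (cases "n + m \<le> N")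
        case True
        then show ?thesis using e[of l] C(1) by simp
      next
        case False
        have "norm (?f m) \<le> (\<Sum>i<r. e l * C * (1/2) ^ m)"
        proof (rule sum_norm_le)
          fix i assume i: "i \<in> {..<r}"
          have "norm (qmul (qcnj (Sc m i k)) (?p l (n + m) i)) \<le> (C * 2 ^ m) * (e l * (1/4) ^ (n + m))"
            unfolding norm_qmul norm_qcnj using C(1) i k False by (intro mult_mono C(2) le) auto
          also have "\<dots> \<le> (C * 2 ^ m) * (e l * (1/4) ^ m)"
            using C(1) e[of l] by (intro mult_left_mono power_decreasing) auto
          also have "\<dots> = e l * C * (2 * (1/4)) ^ m" unfolding power_mult_distrib by simp
          finally show "norm (qmul (qcnj (Sc m i k)) (?p l (n + m) i)) \<le> e l * C * (1/2) ^ m"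
            by simp
        qed
        then show ?thesis using False by (simp add: mult_ac)
      qed
      have geo: "(\<lambda>m. e l * (real r * C) * (1/2) ^ m) sums (e l * (real r * C) * (1 / (1 - 1/2)))"
        by (intro sums_mult geometric_sums) simp
      have "norm (\<Sum>m. ?f m - ?g m) \<le> (\<Sum>m. e l * (real r * C) * (1/2) ^ m)"
        by (rule norm_suminf_le[OF bound sums_summable[OF geo]])
      then show "norm (?A l n k - toep r Sc N q n k) \<le> e l * (2 * real r * C)"
        unfolding sums_unique[OF d, symmetric] sums_unique[OF geo, symmetric] by simp
    qed
  qed
  have geo: "(\<lambda>n. ((1/4::real)\<^sup>2) ^ n) sums (1 / (1 - (1/4)\<^sup>2))"
    by (intro geometric_sums) (simp add: power2_eq_square)
  \<comment> \<open>The left side is cut off at N, so that only finitely many limits are taken; on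
    the right the tails contribute a multiple of the square of \<open>e l\<close>.\<close>
  have "(\<Sum>n\<le>N. \<Sum>k<s. (norm (?A l n k))\<^sup>2)
      \<le> (\<Sum>n\<le>N. \<Sum>i<r. (norm (q n i))\<^sup>2) + (e l)\<^sup>2 * (real r * (1 / (1 - (1/4)\<^sup>2)))" for l
  proof -
    let ?h = "\<lambda>n. if n \<in> {..N} then \<Sum>i<r. (norm (q n i))\<^sup>2 else 0"
    let ?b = "\<lambda>n. (e l)\<^sup>2 * (real r * ((1/4)\<^sup>2) ^ n)"
    have s: "(\<lambda>n. ?h n + ?b n) sums ((\<Sum>n\<le>N. \<Sum>i<r. (norm (q n i))\<^sup>2)
        + (e l)\<^sup>2 * (real r * (1 / (1 - (1/4)\<^sup>2))))"
      by (intro sums_add sums_mult geo sums_If_finite_set) simp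
    have "(\<Sum>n\<le>N. \<Sum>k<s. (norm (?A l n k))\<^sup>2) \<le> (\<Sum>n. \<Sum>i<r. (norm (?p l n i))\<^sup>2)"
      using avec_partial_le[where N = "Suc N" and pts = "pts l" and cs = "cs l" and M = N, OF S] pts by auto
    also have "\<dots> \<le> (\<Sum>n. ?h n + ?b n)"
    proof (rule suminf_le)
      show "summable (\<lambda>n. \<Sum>i<r. (norm (?p l n i))\<^sup>2)"
        using pts by (intro summable_sum pvec_summable)
      show "summable (\<lambda>n. ?h n + ?b n)" using s by (rule sums_summable)
      show "(\<Sum>i<r. (norm (?p l n i))\<^sup>2) \<le> ?h n + ?b n" for n
      proof (cases "n \<le> N")
        case True
        then show ?thesis by (simp add: eq)
      next
        case False
        have "(\<Sum>i<r. (norm (?p l n i))\<^sup>2) \<le> (\<Sum>i<r. (e l * (1/4) ^ n)\<^sup>2)"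
          using False by (intro sum_mono power_mono le) auto
        also have "\<dots> = ?b n" by (simp add: power_mult_distrib power_mult[symmetric] mult_ac)
        finally show ?thesis using False by simp
      qed
    qed
    finally show ?thesis unfolding sums_unique[OF s, symmetric] .
  qed
  moreover have "(\<lambda>l. \<Sum>n\<le>N. \<Sum>k<s. (norm (?A l n k))\<^sup>2)
      \<longlonglongrightarrow> (\<Sum>n\<le>N. \<Sum>k<s. (norm (toep r Sc N q n k))\<^sup>2)"
    by (intro tendsto_sum tendsto_power tendsto_norm A_lim) simp
  moreover have "(\<lambda>l. (\<Sum>n\<le>N. \<Sum>i<r. (norm (q n i))\<^sup>2) + (e l)\<^sup>2 * (real r * (1 / (1 - (1/4)\<^sup>2))))
      \<longlonglongrightarrow> (\<Sum>n\<le>N. \<Sum>i<r. (norm (q n i))\<^sup>2) + 0\<^sup>2 * (real r * (1 / (1 - (1/4)\<^sup>2)))"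
    by (intro tendsto_intros e0)
  ultimately show ?thesis
    using LIMSEQ_le by (metis (no_types, lifting) add.right_neutral mult_zero_left power_zero_numeral)
qed

section \<open>From the row contraction to its adjoint\<close>

lemma quadratic_nonneg_discriminant:
  fixes a b c :: real
  assumes "c \<ge> 0" "\<And>t. 0 \<le> a + 2 * t * b + t\<^sup>2 * c"
  shows "b\<^sup>2 \<le> a * c"
proof (cases "c = 0")
  case True
  have "b = 0"
  proof (rule ccontr)
    assume "b \<noteq> 0"
    \<comment> \<open>For c = 0 the expression is affine in t, and this t makes it equal to
      -1.\<close>
    with assms(2)[of "- (a + 1) / (2 * b)"] True show False by (simp add: field_simps)
  qed
  with True show ?thesis by simp
next
  case False
  with assms(1) have c: "c > 0" by simp
  have "0 \<le> a + 2 * (- b / c) * b + (- b / c)\<^sup>2 * c" by (rule assms)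
  also have "\<dots> = a - b\<^sup>2 / c" using c by (simp add: field_simps power2_eq_square)
  finally show ?thesis using c by (simp add: field_simps)
qed

text \<open>The difference of the two sides is a nonnegative quadratic form in (\<tau>, t), so its
  determinant is nonnegative; cancelling \<alpha> U gives the claim. For \<alpha> = 0, where nothing
  can be cancelled, \<tau> = 0 and t = 1 suffice.\<close>

lemma row_contraction_scalar:
  fixes U \<alpha> \<beta> D :: real
  assumes "\<alpha> \<ge> 0" "\<And>\<tau> t. (\<tau> * \<alpha> + t * \<beta>)\<^sup>2 \<le> U * (\<tau>\<^sup>2 * \<alpha> + t\<^sup>2 * D)"
  shows "\<beta>\<^sup>2 \<le> (U - \<alpha>) * D"
proof (cases "\<alpha> = 0")
  case True
  with assms(2)[of 0 1] show ?thesis by simp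
next
  case False
  with assms(1) have \<alpha>: "\<alpha> > 0" by simp
  have "\<alpha> * \<alpha> \<le> U * \<alpha>" using assms(2)[of 1 0] by (simp add: power2_eq_square)
  with \<alpha> have U: "\<alpha> \<le> U" by simp
  have "U * D - \<beta>\<^sup>2 \<ge> 0" using assms(2)[of 0 1] by simp
  moreover have "0 \<le> (U * \<alpha> - \<alpha>\<^sup>2) + 2 * t * (- \<alpha> * \<beta>) + t\<^sup>2 * (U * D - \<beta>\<^sup>2)" for t
    using assms(2)[of 1 t] by (simp add: power2_eq_square algebra_simps)
  ultimately have "(- \<alpha> * \<beta>)\<^sup>2 \<le> (U * \<alpha> - \<alpha>\<^sup>2) * (U * D - \<beta>\<^sup>2)"
    by (rule quadratic_nonneg_discriminant)
  then have "(\<alpha> * U) * \<beta>\<^sup>2 \<le> (\<alpha> * U) * ((U - \<alpha>) * D)"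
    by (simp add: power2_eq_square algebra_simps)
  then show ?thesis using \<alpha> U by simp
qed

lemma sum_inner_squared_le:
  fixes x y :: "'i \<Rightarrow> 'v::real_inner"
  shows "(\<Sum>k\<in>A. inner (x k) (y k))\<^sup>2 \<le> (\<Sum>k\<in>A. (norm (x k))\<^sup>2) * (\<Sum>k\<in>A. (norm (y k))\<^sup>2)"
proof -
  have "\<bar>\<Sum>k\<in>A. inner (x k) (y k)\<bar> \<le> (\<Sum>k\<in>A. norm (x k) * norm (y k))"
    by (rule order_trans[OF sum_abs]) (intro sum_mono Cauchy_Schwarz_ineq2)
  then have "(\<Sum>k\<in>A. inner (x k) (y k))\<^sup>2 \<le> (\<Sum>k\<in>A. norm (x k) * norm (y k))\<^sup>2"
    by (metis abs_ge_zero power2_abs power_mono)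
  also have "\<dots> \<le> (\<Sum>k\<in>A. (norm (x k))\<^sup>2) * (\<Sum>k\<in>A. (norm (y k))\<^sup>2)"
    by (rule Cauchy_Schwarz_ineq_sum)
  finally show ?thesis .
qed

definition Scol :: "nat \<Rightarrow> (nat \<Rightarrow> nat \<Rightarrow> nat \<Rightarrow> quat) \<Rightarrow> (nat \<Rightarrow> quat) \<Rightarrow> nat \<Rightarrow> nat \<Rightarrow> quat" where
  "Scol s Sc u n i = (\<Sum>k<s. qmul (Sc n i k) (u k))"

text \<open>The right-hand side of the norm estimate, as \<open>Sval Sc 0\<close> and
  \<open>Sc 0\<close> coincide.\<close>

definition defect :: "nat \<Rightarrow> nat \<Rightarrow> (nat \<Rightarrow> nat \<Rightarrow> nat \<Rightarrow> quat) \<Rightarrow> (nat \<Rightarrow> quat) \<Rightarrow> real" where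
  "defect r s Sc u = (\<Sum>k<s. (norm (u k))\<^sup>2) - (\<Sum>i<r. (norm (Scol s Sc u 0 i))\<^sup>2)"

lemma Scol_adjoint:
  "(\<Sum>k<s. inner (u k) (\<Sum>i<r. qmul (qcnj (Sc n i k)) (z i))) = (\<Sum>i<r. inner (z i) (Scol s Sc u n i))"
proof -
  have "inner (u k) (qmul (qcnj (Sc n i k)) (z i)) = inner (z i) (qmul (Sc n i k) (u k))" for i k
    using inner_commute[of "z i" "qmul (Sc n i k) (u k)"] by (simp add: inner_qmul_left[of "u k"])
  then show ?thesis
    unfolding Scol_def inner_sum_right by (subst sum.swap) simp
qed

lemma toep_scaleR: "toep r Sc N (\<lambda>n i. t *\<^sub>R p n i) n k = t *\<^sub>R toep r Sc N p n k"
  by (simp add: toep_def qmul_lin.scaleR_right scaleR_sum_right)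

text \<open>Deleting row and column 0 of an upper triangular Toeplitz matrix returns a matrix of the
  same kind, so a prefixed entry affects row 0 alone.\<close>

lemma toep_Suc: "toep r Sc (Suc N) q (Suc n) k = toep r Sc N (\<lambda>n. q (Suc n)) n k"
  by (simp add: toep_def)

lemma toep_0_Suc:
  "toep r Sc (Suc N) q 0 k = (\<Sum>i<r. qmul (qcnj (Sc 0 i k)) (q 0 i))
     + (\<Sum>m\<le>N. \<Sum>i<r. qmul (qcnj (Sc (Suc m) i k)) (q (Suc m) i))"
  unfolding toep_def by (simp add: atMost_def[symmetric] sum.atMost_Suc_shift del: sum.atMost_Suc)

text \<open>The sequence \<open>p\<close> is prefixed with a multiple of S_0 u. Pairing row 0 of the
  Toeplitz image with u then gives \<tau> \<alpha> + t \<beta>, and Cauchy-Schwarz leads to the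
  hypothesis of \<open>row_contraction_scalar\<close>.\<close>

lemma shifted_contraction:
  assumes S: "schur_multiplier r s Sc"
  shows "(\<Sum>m\<le>N. \<Sum>i<r. inner (p m i) (Scol s Sc u (Suc m) i))\<^sup>2
    \<le> defect r s Sc u *
        ((\<Sum>n\<le>N. \<Sum>i<r. (norm (p n i))\<^sup>2) - (\<Sum>n\<le>N. \<Sum>k<s. (norm (toep r Sc N p n k))\<^sup>2))"
    (is "?\<beta>\<^sup>2 \<le> _ * ?D")
proof -
  define f where "f = Scol s Sc u 0"
  define \<alpha> where "\<alpha> = (\<Sum>i<r. (norm (f i))\<^sup>2)"
  define U where "U = (\<Sum>k<s. (norm (u k))\<^sup>2)"
  define a where "a k = (\<Sum>i<r. qmul (qcnj (Sc 0 i k)) (f i))" for k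
  define g where "g k = (\<Sum>m\<le>N. \<Sum>i<r. qmul (qcnj (Sc (Suc m) i k)) (p m i))" for k
  have "?\<beta>\<^sup>2 \<le> (U - \<alpha>) * ?D"
  proof (rule row_contraction_scalar)
    show "\<alpha> \<ge> 0" unfolding \<alpha>_def by (intro sum_nonneg) simp
    fix \<tau> t
    define q where "q n i = (case n of 0 \<Rightarrow> \<tau> *\<^sub>R f i | Suc n \<Rightarrow> t *\<^sub>R p n i)" for n i
    have q: "q 0 = (\<lambda>i. \<tau> *\<^sub>R f i)" "\<And>n. q (Suc n) = (\<lambda>i. t *\<^sub>R p n i)"
      by (simp_all add: q_def fun_eq_iff)
    have t0: "toep r Sc (Suc N) q 0 k = \<tau> *\<^sub>R a k + t *\<^sub>R g k" for k
      unfolding toep_0_Suc q a_def g_def by (simp add: qmul_lin.scaleR_right scaleR_sum_right)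
    have tS: "toep r Sc (Suc N) q (Suc n) k = t *\<^sub>R toep r Sc N p n k" for n k
      unfolding toep_Suc q toep_scaleR ..
    \<comment> \<open>Row 0 is split off from the contraction for \<open>q\<close>; the other rows
      are the scaled image of \<open>p\<close>, and moving them to the right produces the second
      factor of the claim.\<close>
    have contr: "(\<Sum>k<s. (norm (\<tau> *\<^sub>R a k + t *\<^sub>R g k))\<^sup>2)
          + t\<^sup>2 * (\<Sum>n\<le>N. \<Sum>k<s. (norm (toep r Sc N p n k))\<^sup>2)
       \<le> \<tau>\<^sup>2 * \<alpha> + t\<^sup>2 * (\<Sum>n\<le>N. \<Sum>i<r. (norm (p n i))\<^sup>2)"
      using toep_contraction[OF S, of "Suc N" q]
      unfolding sum.atMost_Suc_shift t0 tS q \<alpha>_def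
      by (simp add: power_mult_distrib sum_distrib_left)
    have "(\<Sum>k<s. inner (u k) (a k)) = \<alpha>"
      unfolding a_def Scol_adjoint \<alpha>_def f_def by (simp add: power2_norm_eq_inner)
    moreover have "(\<Sum>k<s. inner (u k) (g k)) = ?\<beta>"
      unfolding g_def inner_sum_right[of _ _ "{..N}"]
      by (subst sum.swap) (simp add: Scol_adjoint)
    ultimately have "(\<tau> * \<alpha> + t * ?\<beta>)\<^sup>2 = (\<Sum>k<s. inner (u k) (\<tau> *\<^sub>R a k + t *\<^sub>R g k))\<^sup>2"
      by (simp add: inner_add_right sum.distrib sum_distrib_left[symmetric])
    also have "\<dots> \<le> U * (\<Sum>k<s. (norm (\<tau> *\<^sub>R a k + t *\<^sub>R g k))\<^sup>2)"
      unfolding U_def by (rule sum_inner_squared_le)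
    also have "\<dots> \<le> U * (\<tau>\<^sup>2 * \<alpha> + t\<^sup>2 * ?D)"
      using contr by (intro mult_left_mono) (auto simp: U_def right_diff_distrib intro: sum_nonneg)
    finally show "(\<tau> * \<alpha> + t * ?\<beta>)\<^sup>2 \<le> U * (\<tau>\<^sup>2 * \<alpha> + t\<^sup>2 * ?D)" .
  qed
  then show ?thesis by (simp add: U_def \<alpha>_def f_def defect_def)
qed

text \<open>The section with N = 0 says that the adjoint of S_0 is a contraction; testing it on S_0
  u and pairing with u gives the same for S_0.\<close>

lemma defect_nonneg:
  assumes "schur_multiplier r s Sc"
  shows "0 \<le> defect r s Sc u"
proof -
  let ?f = "Scol s Sc u 0"
  let ?\<alpha> = "\<Sum>i<r. (norm (?f i))\<^sup>2" and ?U = "\<Sum>k<s. (norm (u k))\<^sup>2"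
  have t: "toep r Sc 0 (\<lambda>_. ?f) 0 k = (\<Sum>i<r. qmul (qcnj (Sc 0 i k)) (?f i))" for k
    by (simp add: toep_def)
  have "?\<alpha>\<^sup>2 = (\<Sum>k<s. inner (u k) (toep r Sc 0 (\<lambda>_. ?f) 0 k))\<^sup>2"
    unfolding t Scol_adjoint by (simp add: power2_norm_eq_inner)
  also have "\<dots> \<le> ?U * (\<Sum>k<s. (norm (toep r Sc 0 (\<lambda>_. ?f) 0 k))\<^sup>2)"
    by (rule sum_inner_squared_le)
  also have "\<dots> \<le> ?U * ?\<alpha>"
    using toep_contraction[OF assms, of 0 "\<lambda>_. ?f"] by (intro mult_left_mono) (auto intro: sum_nonneg)
  finally have *: "?\<alpha> * ?\<alpha> \<le> ?U * ?\<alpha>" by (simp add: power2_eq_square)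
  have "?\<alpha> \<ge> 0" "?U \<ge> 0" by (intro sum_nonneg; simp)+
  with * have "?\<alpha> \<le> ?U" by (cases "?\<alpha> = 0") auto
  then show ?thesis by (simp add: defect_def)
qed

text \<open>\<open>shifted_contraction\<close> is tested on the sequence concentrated in degree n
  whose value is the column itself. The bound is uniform in n, which makes the series of R_0(Su)
  converge on \<open>Ell\<close>.\<close>

lemma Scol_bound:
  assumes S: "schur_multiplier r s Sc" and i: "i < r"
  shows "(norm (Scol s Sc u (Suc n) i))\<^sup>2 \<le> defect r s Sc u"
proof -
  let ?f = "Scol s Sc u (Suc n)"
  let ?\<alpha> = "\<Sum>i<r. (norm (?f i))\<^sup>2"
  define p where "p m j = (if m = n then ?f j else 0)" for m j
  have 1: "(\<Sum>m\<le>n. \<Sum>j<r. inner (p m j) (Scol s Sc u (Suc m) j)) = ?\<alpha>"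
    by (subst sum.cong[where h = "\<lambda>m. if m = n then ?\<alpha> else 0", OF refl])
      (auto simp: p_def power2_norm_eq_inner)
  have 2: "(\<Sum>m\<le>n. \<Sum>j<r. (norm (p m j))\<^sup>2) = ?\<alpha>"
    by (subst sum.cong[where h = "\<lambda>m. if m = n then ?\<alpha> else 0", OF refl]) (auto simp: p_def)
  have "?\<alpha>\<^sup>2 \<le> defect r s Sc u * (?\<alpha> - (\<Sum>m\<le>n. \<Sum>k<s. (norm (toep r Sc n p m k))\<^sup>2))"
    using shifted_contraction[where p = p and N = n and u = u, OF S] unfolding 1 2 .
  also have "\<dots> \<le> defect r s Sc u * ?\<alpha>"
    by (intro mult_left_mono defect_nonneg[OF S]) (simp add: sum_nonneg)
  finally have *: "?\<alpha> * ?\<alpha> \<le> defect r s Sc u * ?\<alpha>" by (simp add: power2_eq_square)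
  have "(norm (?f i))\<^sup>2 \<le> ?\<alpha>" using i by (intro member_le_sum) auto
  also have "?\<alpha> \<le> defect r s Sc u"
  proof (cases "?\<alpha> = 0")
    case False
    moreover have "?\<alpha> \<ge> 0" by (intro sum_nonneg) simp
    ultimately show ?thesis using * by simp
  qed (use defect_nonneg[OF S] in simp)
  finally show ?thesis .
qed

section \<open>The functional induced by R_0(Su)\<close>

lemma R0Su_summable:
  assumes S: "schur_multiplier r s Sc" and x: "x \<in> Ell" and i: "i < r"
  shows "summable (\<lambda>n. qmul (Ppoly n x) (Scol s Sc u (Suc n) i))"
proof -
  obtain C \<rho> where C: "C \<ge> 0" "0 \<le> \<rho>" "\<rho> < 1" "\<And>n. norm (Ppoly n x) \<le> C * \<rho> ^ n"
    using Ppoly_geometric_bound[OF x] by blast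
  have b: "norm (Scol s Sc u (Suc n) i) \<le> sqrt (defect r s Sc u)" for n
    by (rule real_le_rsqrt[OF Scol_bound[OF S i]])
  show ?thesis
  proof (rule summable_comparison_test'[of "\<lambda>n. C * sqrt (defect r s Sc u) * \<rho> ^ n"])
    show "summable (\<lambda>n. C * sqrt (defect r s Sc u) * \<rho> ^ n)"
      using C by (intro summable_mult summable_geometric) simp
    fix n
    have "norm (qmul (Ppoly n x) (Scol s Sc u (Suc n) i)) \<le> (C * \<rho> ^ n) * sqrt (defect r s Sc u)"
      unfolding norm_qmul using C by (intro mult_mono C(4) b) auto
    then show "norm (qmul (Ppoly n x) (Scol s Sc u (Suc n) i)) \<le> C * sqrt (defect r s Sc u) * \<rho> ^ n"
      by (simp add: mult_ac)
  qed
qed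

text \<open>In coefficients the functional pairs \<open>pvec\<close> with the shifted columns, so it
  is a limit of the quantities in \<open>shifted_contraction\<close>. Two limits are taken: first
  the truncation degree L at a fixed row cutoff M, then M.\<close>

lemma R0Su_functional_bound:
  assumes S: "schur_multiplier r s Sc" and pts: "\<And>a. a < N \<Longrightarrow> pts a \<in> Ell"
  shows "(\<Sum>a<N. \<Sum>i<r. inner (cs a i) (R0Su r s Sc u (pts a) i))\<^sup>2
     \<le> defect r s Sc u * kform r (KS s Sc) N pts cs"
proof -
  let ?p = "pvec N pts cs" and ?v = "\<lambda>n. Scol s Sc u (Suc n)"
  let ?F = "\<Sum>a<N. \<Sum>i<r. inner (cs a i) (R0Su r s Sc u (pts a) i)"
  let ?\<kappa> = "defect r s Sc u"
  have "(\<lambda>n. \<Sum>a<N. \<Sum>i<r. inner (cs a i) (qmul (Ppoly n (pts a)) (?v n i))) sums ?F"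
  proof (intro sums_sum)
    fix a i assume *: "a \<in> {..<N}" "i \<in> {..<r}"
    then have "(\<lambda>n. qmul (Ppoly n (pts a)) (?v n i)) sums R0Su r s Sc u (pts a) i"
      using R0Su_summable[OF S pts, of a i u] pts by (simp add: R0Su_def Scol_def summable_sums)
    then show "(\<lambda>n. inner (cs a i) (qmul (Ppoly n (pts a)) (?v n i))) sums inner (cs a i) (R0Su r s Sc u (pts a) i)"
      by (rule bounded_linear.sums[OF bounded_linear_inner_right])
  qed
  moreover have "(\<Sum>a<N. \<Sum>i<r. inner (cs a i) (qmul (Ppoly n (pts a)) (?v n i)))
      = (\<Sum>i<r. inner (?p n i) (?v n i))" for n
    unfolding pvec_def inner_sum_left by (subst sum.swap) (simp add: inner_qmul_left)
  ultimately have F: "(\<lambda>n. \<Sum>i<r. inner (?p n i) (?v n i)) sums ?F" by simp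
  have P: "summable (\<lambda>n. \<Sum>i<r. (norm (?p n i))\<^sup>2)"
    by (intro summable_sum pvec_summable pts)
  have T: "(\<lambda>L. toep r Sc L ?p n k) \<longlonglongrightarrow> avec r Sc N pts cs n k" if k: "k < s" for n k
  proof -
    have "{m. n + m \<le> L} = {..<Suc L - n}" for L by auto
    then have eq: "toep r Sc L ?p n k
        = (\<Sum>m<Suc L - n. \<Sum>i<r. qmul (qcnj (Sc m i k)) (?p (n + m) i))" for L
      by (simp add: toep_def)
    have "filterlim (\<lambda>L. Suc L - n) sequentially sequentially"
      unfolding filterlim_at_top
    proof
      fix Z
      show "\<forall>\<^sub>F L in sequentially. Z \<le> Suc L - n"
        by (rule eventually_sequentiallyI[of "Z + n"]) simp
    qed
    moreover have "(\<lambda>K. \<Sum>m<K. \<Sum>i<r. qmul (qcnj (Sc m i k)) (?p (n + m) i))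
        \<longlonglongrightarrow> avec r Sc N pts cs n k"
      using avec_sums[where N = N and pts = pts and cs = cs and n = n, OF S pts k] by (simp add: sums_def)
    ultimately show ?thesis
      unfolding eq by (rule filterlim_compose[rotated])
  qed
  \<comment> \<open>Rows beyond M may be dropped because they enter with a minus sign and the defect
    is nonnegative. Only finitely many Toeplitz rows then pass to the limit in L, each tending to
    \<open>avec\<close>.\<close>
  have bound: "?F\<^sup>2 \<le> ?\<kappa> * ((\<Sum>n. \<Sum>i<r. (norm (?p n i))\<^sup>2)
      - (\<Sum>n\<le>M. \<Sum>k<s. (norm (avec r Sc N pts cs n k))\<^sup>2))" for M
  proof (rule LIMSEQ_le)
    show "(\<lambda>L. (\<Sum>n\<le>L. \<Sum>i<r. inner (?p n i) (?v n i))\<^sup>2) \<longlonglongrightarrow> ?F\<^sup>2"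
      using F unfolding sums_def_le by (rule tendsto_power)
    show "(\<lambda>L. ?\<kappa> * ((\<Sum>n\<le>L. \<Sum>i<r. (norm (?p n i))\<^sup>2)
          - (\<Sum>n\<le>M. \<Sum>k<s. (norm (toep r Sc L ?p n k))\<^sup>2)))
        \<longlonglongrightarrow> ?\<kappa> * ((\<Sum>n. \<Sum>i<r. (norm (?p n i))\<^sup>2)
          - (\<Sum>n\<le>M. \<Sum>k<s. (norm (avec r Sc N pts cs n k))\<^sup>2))"
      by (intro tendsto_intros T summable_sums[OF P, unfolded sums_def_le]) simp
    show "\<exists>L0. \<forall>L\<ge>L0. (\<Sum>n\<le>L. \<Sum>i<r. inner (?p n i) (?v n i))\<^sup>2
      \<le> ?\<kappa> * ((\<Sum>n\<le>L. \<Sum>i<r. (norm (?p n i))\<^sup>2)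
          - (\<Sum>n\<le>M. \<Sum>k<s. (norm (toep r Sc L ?p n k))\<^sup>2))"
    proof (intro exI allI impI)
      fix L assume "M \<le> L"
      then have "(\<Sum>n\<le>M. \<Sum>k<s. (norm (toep r Sc L ?p n k))\<^sup>2)
          \<le> (\<Sum>n\<le>L. \<Sum>k<s. (norm (toep r Sc L ?p n k))\<^sup>2)"
        by (intro sum_mono2) (auto intro: sum_nonneg)
      then show "(\<Sum>n\<le>L. \<Sum>i<r. inner (?p n i) (?v n i))\<^sup>2
        \<le> ?\<kappa> * ((\<Sum>n\<le>L. \<Sum>i<r. (norm (?p n i))\<^sup>2)
            - (\<Sum>n\<le>M. \<Sum>k<s. (norm (toep r Sc L ?p n k))\<^sup>2))"
        by (intro order_trans[OF shifted_contraction[OF S]] mult_left_mono defect_nonneg[OF S]) simp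
    qed
  qed
  have "(\<lambda>M. \<Sum>n\<le>M. \<Sum>k<s. (norm (avec r Sc N pts cs n k))\<^sup>2)
     \<longlonglongrightarrow> (\<Sum>n. \<Sum>i<r. (norm (?p n i))\<^sup>2) - kform r (KS s Sc) N pts cs"
    using avec_norm_sums[where cs = cs and pts = pts and N = N, OF S pts] by (simp add: sums_def_le)
  then have "(\<lambda>M. ?\<kappa> * ((\<Sum>n. \<Sum>i<r. (norm (?p n i))\<^sup>2)
        - (\<Sum>n\<le>M. \<Sum>k<s. (norm (avec r Sc N pts cs n k))\<^sup>2)))
     \<longlonglongrightarrow> ?\<kappa> * ((\<Sum>n. \<Sum>i<r. (norm (?p n i))\<^sup>2)
        - ((\<Sum>n. \<Sum>i<r. (norm (?p n i))\<^sup>2) - kform r (KS s Sc) N pts cs))"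
    by (intro tendsto_intros)
  then have "?F\<^sup>2 \<le> ?\<kappa> * ((\<Sum>n. \<Sum>i<r. (norm (?p n i))\<^sup>2)
        - ((\<Sum>n. \<Sum>i<r. (norm (?p n i))\<^sup>2) - kform r (KS s Sc) N pts cs))"
    by (rule LIMSEQ_le_const) (use bound in blast)
  then show ?thesis by simp
qed

section \<open>Riesz representation for a real form\<close>

text \<open>The Hilbert space of the theorem is a set of functions with its own inner product, not a
  type, so the real Hilbert space arguments are made for an abstract form on a carrier set.\<close>

locale real_form_space =
  fixes V :: "'v set" and add :: "'v \<Rightarrow> 'v \<Rightarrow> 'v" and scl :: "real \<Rightarrow> 'v \<Rightarrow> 'v" and B :: "'v \<Rightarrow> 'v \<Rightarrow> real"
  assumes add_closed: "f \<in> V \<Longrightarrow> g \<in> V \<Longrightarrow> add f g \<in> V"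
    and scl_closed: "f \<in> V \<Longrightarrow> scl t f \<in> V"
    and B_add: "f \<in> V \<Longrightarrow> g \<in> V \<Longrightarrow> h \<in> V \<Longrightarrow> B (add f g) h = B f h + B g h"
    and B_scl: "f \<in> V \<Longrightarrow> h \<in> V \<Longrightarrow> B (scl t f) h = t * B f h"
    and B_sym: "f \<in> V \<Longrightarrow> g \<in> V \<Longrightarrow> B f g = B g f"
    and B_nonneg: "f \<in> V \<Longrightarrow> 0 \<le> B f f"
begin

definition lin :: "'v \<Rightarrow> real \<Rightarrow> 'v \<Rightarrow> 'v" where "lin f t g = add f (scl t g)"

lemma lin_closed: "f \<in> V \<Longrightarrow> g \<in> V \<Longrightarrow> lin f t g \<in> V"
  by (simp add: lin_def add_closed scl_closed)

lemma B_lin: "f \<in> V \<Longrightarrow> g \<in> V \<Longrightarrow> h \<in> V \<Longrightarrow> B (lin f t g) h = B f h + t * B g h"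
  by (simp add: lin_def B_add B_scl scl_closed)

lemma B_lin_lin:
  assumes "f \<in> V" "g \<in> V"
  shows "B (lin f t g) (lin f t g) = B f f + 2 * t * B f g + t\<^sup>2 * B g g"
proof -
  let ?l = "lin f t g"
  have l: "?l \<in> V" using assms by (rule lin_closed)
  have "B ?l ?l = B f ?l + t * B g ?l" using assms l by (rule B_lin)
  also have "B f ?l = B ?l f" using assms(1) l by (rule B_sym)
  also have "B g ?l = B ?l g" using assms(2) l by (rule B_sym)
  also have "B ?l f = B f f + t * B g f" using assms assms(1) by (rule B_lin)
  also have "B ?l g = B f g + t * B g g" using assms assms(2) by (rule B_lin)
  also have "B g f = B f g" using assms(2,1) by (rule B_sym)
  finally show ?thesis by (simp add: power2_eq_square algebra_simps)
qed

lemma B_Cauchy_Schwarz: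
  assumes "f \<in> V" "g \<in> V"
  shows "(B f g)\<^sup>2 \<le> B f f * B g g"
  using B_nonneg[OF assms(2)] B_nonneg[OF lin_closed[OF assms]] unfolding B_lin_lin[OF assms]
  by (rule quadratic_nonneg_discriminant)

text \<open>The functional is given by its graph \<open>\<Gamma>\<close>; its representing vector is the limit of a
  minimizing sequence of \<open>B g g - 2 \<phi> g\<close>.\<close>

lemma riesz_graph:
  assumes complete: "\<And>F :: nat \<Rightarrow> 'v. (\<And>n. F n \<in> V) \<Longrightarrow>
      (\<And>e. e > 0 \<Longrightarrow> \<exists>M. \<forall>m\<ge>M. \<forall>n\<ge>M. sqrt (B (lin (F m) (-1) (F n)) (lin (F m) (-1) (F n))) < e) \<Longrightarrow>
      \<exists>f\<in>V. (\<lambda>n. sqrt (B (lin (F n) (-1) f) (lin (F n) (-1) f))) \<longlonglongrightarrow> 0"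
    and \<Gamma>_V: "\<And>g \<phi>. (g, \<phi>) \<in> \<Gamma> \<Longrightarrow> g \<in> V"
    and \<Gamma>_ne: "\<Gamma> \<noteq> {}"
    and \<Gamma>_lin: "\<And>g \<phi> h \<psi> t. (g, \<phi>) \<in> \<Gamma> \<Longrightarrow> (h, \<psi>) \<in> \<Gamma> \<Longrightarrow> (lin g t h, \<phi> + t * \<psi>) \<in> \<Gamma>"
    and \<kappa>: "\<kappa> \<ge> 0" "\<And>g \<phi>. (g, \<phi>) \<in> \<Gamma> \<Longrightarrow> \<phi>\<^sup>2 \<le> \<kappa> * B g g"
  obtains f where "f \<in> V" "B f f \<le> \<kappa>" "\<And>g \<phi>. (g, \<phi>) \<in> \<Gamma> \<Longrightarrow> B f g = \<phi>"
proof -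
  define J where "J = (\<lambda>(g, \<phi>). B g g - 2 * \<phi>)"
  \<comment> \<open>The inequality 4 \<kappa> B \<le> (B + \<kappa>)^2 turns the bound on \<phi>
    into a lower bound for \<open>J\<close>.\<close>
  have J_ge: "- \<kappa> \<le> J \<gamma>" if "\<gamma> \<in> \<Gamma>" for \<gamma>
  proof -
    obtain g \<phi> where \<gamma>: "\<gamma> = (g, \<phi>)" by (cases \<gamma>)
    have g: "(g, \<phi>) \<in> \<Gamma>" using that \<gamma> by simp
    have "(2 * \<phi>)\<^sup>2 \<le> 4 * (\<kappa> * B g g)" using \<kappa>(2)[OF g] by simp
    also have "\<dots> \<le> (B g g + \<kappa>)\<^sup>2"
      using zero_le_power2[of "B g g - \<kappa>"] by (simp add: power2_eq_square algebra_simps)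
    finally have "2 * \<phi> \<le> B g g + \<kappa>"
      by (rule power2_le_imp_le) (use B_nonneg[OF \<Gamma>_V[OF g]] \<kappa>(1) in simp)
    then show ?thesis by (simp add: J_def \<gamma>)
  qed
  define \<mu> where "\<mu> = Inf (J ` \<Gamma>)"
  have bdd: "bdd_below (J ` \<Gamma>)" using J_ge by (intro bdd_belowI2)
  have \<mu>_le: "\<mu> \<le> J \<gamma>" if "\<gamma> \<in> \<Gamma>" for \<gamma>
    unfolding \<mu>_def using bdd that by (rule cINF_lower)
  define \<delta> where "\<delta> n = 1 / real (Suc n)" for n
  have \<delta>: "\<delta> n > 0" for n by (simp add: \<delta>_def)
  have \<delta>0: "\<delta> \<longlonglongrightarrow> 0"
    unfolding \<delta>_def using LIMSEQ_inverse_real_of_nat by (simp add: inverse_eq_divide)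
  have "\<exists>\<gamma>\<in>\<Gamma>. J \<gamma> < \<mu> + \<delta> n" for n
    using cINF_less_iff[OF \<Gamma>_ne bdd, of "\<mu> + \<delta> n"] \<delta>[of n] by (simp add: \<mu>_def)
  then obtain \<gamma> where \<gamma>: "\<And>n. \<gamma> n \<in> \<Gamma>" "\<And>n. J (\<gamma> n) < \<mu> + \<delta> n" by metis
  define G where "G n = fst (\<gamma> n)" for n
  define \<Phi> where "\<Phi> n = snd (\<gamma> n)" for n
  have \<Gamma>_n: "(G n, \<Phi> n) \<in> \<Gamma>" for n using \<gamma>(1)[of n] by (simp add: G_def \<Phi>_def)
  have G: "G n \<in> V" for n by (rule \<Gamma>_V[OF \<Gamma>_n])
  have J_n: "B (G n) (G n) - 2 * \<Phi> n < \<mu> + \<delta> n" for n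
    using \<gamma>(2)[of n] by (simp add: J_def G_def \<Phi>_def case_prod_beta)
  \<comment> \<open>At \<open>G n\<close> the value of \<open>J\<close> is within
    \<open>\<delta> n\<close> of its infimum, so moving along \<open>g\<close> cannot lower it by
    more than that. The discriminant of this quadratic in t bounds its linear coefficient.\<close>
  have near: "\<bar>B (G n) g - \<phi>\<bar> \<le> sqrt (\<delta> n) * sqrt (B g g)" if g: "(g, \<phi>) \<in> \<Gamma>" for g \<phi> n
  proof -
    have gV: "g \<in> V" using \<Gamma>_V g .
    have "0 \<le> \<delta> n + 2 * t * (B (G n) g - \<phi>) + t\<^sup>2 * B g g" for t
      using \<mu>_le[OF \<Gamma>_lin[OF \<Gamma>_n[of n] g, of t]] J_n[of n]
      by (simp add: J_def B_lin_lin[OF G gV] algebra_simps)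
    with B_nonneg[OF gV] have "(B (G n) g - \<phi>)\<^sup>2 \<le> \<delta> n * B g g" by (rule quadratic_nonneg_discriminant)
    then have "sqrt ((B (G n) g - \<phi>)\<^sup>2) \<le> sqrt (\<delta> n * B g g)" by (rule real_sqrt_le_mono)
    then show ?thesis by (simp add: real_sqrt_mult)
  qed
  \<comment> \<open>\<open>near\<close> is applied to the difference of \<open>G m\<close> and
    \<open>G n\<close> itself, and one factor of its norm cancels.\<close>
  have dist: "sqrt (B (lin (G m) (-1) (G n)) (lin (G m) (-1) (G n))) \<le> sqrt (\<delta> m) + sqrt (\<delta> n)" for m n
  proof -
    let ?g = "lin (G m) (-1) (G n)" and ?\<phi> = "\<Phi> m + (-1) * \<Phi> n"
    have g: "(?g, ?\<phi>) \<in> \<Gamma>" by (rule \<Gamma>_lin[OF \<Gamma>_n \<Gamma>_n])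
    have gV: "?g \<in> V" using \<Gamma>_V g .
    have "B ?g ?g = B (G m) ?g - B (G n) ?g" using B_lin[OF G G gV, of m "-1" n] by simp
    also have "\<dots> \<le> (sqrt (\<delta> m) + sqrt (\<delta> n)) * sqrt (B ?g ?g)"
      using near[OF g, of m] near[OF g, of n] by (simp add: algebra_simps abs_le_iff)
    finally have le: "sqrt (B ?g ?g) * sqrt (B ?g ?g) \<le> (sqrt (\<delta> m) + sqrt (\<delta> n)) * sqrt (B ?g ?g)"
      using B_nonneg[OF gV] by simp
    show ?thesis
    proof (cases "B ?g ?g = 0")
      case True
      then show ?thesis using \<delta>[of m] \<delta>[of n] by simp
    next
      case False
      then have "0 < sqrt (B ?g ?g)" using B_nonneg[OF gV] by simp
      with le show ?thesis by (rule mult_right_le_imp_le)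
    qed
  qed
  have "\<exists>f\<in>V. (\<lambda>n. sqrt (B (lin (G n) (-1) f) (lin (G n) (-1) f))) \<longlonglongrightarrow> 0"
  proof (rule complete[OF G])
    fix e :: real assume "e > 0"
    have "(\<lambda>n. sqrt (\<delta> n)) \<longlonglongrightarrow> sqrt 0" by (intro tendsto_real_sqrt \<delta>0)
    then have "\<forall>\<^sub>F n in sequentially. sqrt (\<delta> n) < e / 2"
      using \<open>e > 0\<close> by (intro order_tendstoD) auto
    then obtain M where M: "\<And>n. n \<ge> M \<Longrightarrow> sqrt (\<delta> n) < e / 2"
      unfolding eventually_sequentially by blast
    show "\<exists>M. \<forall>m\<ge>M. \<forall>n\<ge>M. sqrt (B (lin (G m) (-1) (G n)) (lin (G m) (-1) (G n))) < e"
    proof (intro exI allI impI)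
      fix m n assume "M \<le> m" "M \<le> n"
      then show "sqrt (B (lin (G m) (-1) (G n)) (lin (G m) (-1) (G n))) < e"
        using dist[of m n] M[of m] M[of n] by linarith
    qed
  qed
  then obtain f where f: "f \<in> V"
    and lim: "(\<lambda>n. sqrt (B (lin (G n) (-1) f) (lin (G n) (-1) f))) \<longlonglongrightarrow> 0" by blast
  have lim_B: "(\<lambda>n. B (G n) g) \<longlonglongrightarrow> B f g" if g: "g \<in> V" for g
  proof (rule LIM_zero_cancel, rule Lim_null_comparison)
    show "(\<lambda>n. sqrt (B (lin (G n) (-1) f) (lin (G n) (-1) f)) * sqrt (B g g)) \<longlonglongrightarrow> 0"
      using tendsto_mult_right[OF lim, of "sqrt (B g g)"] by simp
    have "norm (B (G n) g - B f g) \<le> sqrt (B (lin (G n) (-1) f) (lin (G n) (-1) f)) * sqrt (B g g)" for n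
    proof -
      have "B (G n) g - B f g = B (lin (G n) (-1) f) g" using B_lin[OF G f g] by simp
      then show ?thesis
        using real_sqrt_le_mono[OF B_Cauchy_Schwarz[OF lin_closed[OF G f] g, of n "-1"]]
        by (simp add: real_sqrt_mult)
    qed
    then show "\<forall>\<^sub>F n in sequentially. norm (B (G n) g - B f g)
        \<le> sqrt (B (lin (G n) (-1) f) (lin (G n) (-1) f)) * sqrt (B g g)"
      by simp
  qed
  have rep: "B f g = \<phi>" if g: "(g, \<phi>) \<in> \<Gamma>" for g \<phi>
  proof -
    have "(\<lambda>n. B (G n) g) \<longlonglongrightarrow> \<phi>"
    proof (rule LIM_zero_cancel, rule Lim_null_comparison)
      show "(\<lambda>n. sqrt (\<delta> n) * sqrt (B g g)) \<longlonglongrightarrow> 0"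
        using tendsto_mult_right[OF tendsto_real_sqrt[OF \<delta>0], of "sqrt (B g g)"] by simp
      show "\<forall>\<^sub>F n in sequentially. norm (B (G n) g - \<phi>) \<le> sqrt (\<delta> n) * sqrt (B g g)"
        using near[OF g] by simp
    qed
    then show ?thesis using lim_B[OF \<Gamma>_V[OF g]] by (rule LIMSEQ_unique[symmetric])
  qed
  have Gf: "B (G n) f = \<Phi> n" for n using rep[OF \<Gamma>_n] B_sym[OF G f] by simp
  have 1: "(\<lambda>n. \<Phi> n) \<longlonglongrightarrow> B f f" using lim_B[OF f] unfolding Gf .
  have d: "B (lin (G n) (-1) f) (lin (G n) (-1) f) = B (G n) (G n) - 2 * \<Phi> n + B f f" for n
    unfolding B_lin_lin[OF G f] Gf by simp
  have "(\<lambda>n. (sqrt (B (lin (G n) (-1) f) (lin (G n) (-1) f)))\<^sup>2) \<longlonglongrightarrow> 0\<^sup>2"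
    by (intro tendsto_power lim)
  then have "(\<lambda>n. B (G n) (G n) - 2 * \<Phi> n + B f f) \<longlonglongrightarrow> 0"
    unfolding d real_sqrt_pow2[OF B_nonneg[OF lin_closed[OF G f, where t = "-1"], unfolded d]] by simp
  from tendsto_add[OF this tendsto_diff[OF tendsto_mult_left[OF 1, of 2] tendsto_const[of "B f f"]]]
  have 2: "(\<lambda>n. B (G n) (G n)) \<longlonglongrightarrow> B f f" by simp
  \<comment> \<open>The limit \<open>f\<close> may lie outside the graph, so its norm is bounded by
    passing to the limit in the inequality along \<open>G n\<close>.\<close>
  have "(B f f)\<^sup>2 \<le> \<kappa> * B f f"
    by (rule LIMSEQ_le[OF tendsto_power[OF 1] tendsto_mult_left[OF 2]]) (use \<kappa>(2)[OF \<Gamma>_n] in blast)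
  then have "B f f \<le> \<kappa>"
    using B_nonneg[OF f] \<kappa>(1) by (cases "B f f = 0") (auto simp: power2_eq_square)
  with f rep show ?thesis using that by blast
qed

end

section \<open>Membership in the reproducing kernel space\<close>

lemma sum_concat:
  fixes f :: "'b \<Rightarrow> 'a::comm_monoid_add" and N M :: nat
  shows "(\<Sum>a<N + M. f (if a < N then X a else Y (a - N))) = (\<Sum>a<N. f (X a)) + (\<Sum>a<M. f (Y a))"
  by (induction M) (simp_all add: add.assoc)

text \<open>The bound makes the functional that pairs coefficients with values of \<open>F\<close>
  continuous on kernel combinations; by the reproducing property its Riesz representer has the same
  values as \<open>F\<close>.\<close>

lemma RKHS_membership:
  assumes RK: "is_RKHS r K V ip" and \<kappa>: "\<kappa> \<ge> 0"
    and F0: "\<And>x i. x \<notin> Ell \<or> r \<le> i \<Longrightarrow> F x i = 0"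
    and bound: "\<And>N pts cs. (\<And>a. a < N \<Longrightarrow> pts a \<in> Ell) \<Longrightarrow>
       (\<Sum>a<N. \<Sum>i<r. inner (cs a i) (F (pts a) i))\<^sup>2 \<le> \<kappa> * kform r K N pts cs"
  shows "F \<in> V \<and> (ipnorm ip F)\<^sup>2 \<le> \<kappa>"
proof -
  let ?add = "\<lambda>f g (x::quat) (i::nat). f x i + g x i :: quat"
  let ?scl = "\<lambda>t f (x::quat) (i::nat). t *\<^sub>R f x i :: quat"
  define B where "B f g = q0 (ip f g)" for f g
  note R1 = RK[unfolded is_RKHS_def]
  note R2 = conjunct2[OF R1] note R3 = conjunct2[OF R2] note R4 = conjunct2[OF R3]
  note R5 = conjunct2[OF R4] note R6 = conjunct2[OF R5] note R7 = conjunct2[OF R6]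
  note R8 = conjunct2[OF R7] note R9 = conjunct2[OF R8] note R10 = conjunct2[OF R9]
  note R11 = conjunct2[OF R10] note R12 = conjunct2[OF R11]
  note zero = conjunct1[OF R1, rule_format] and zeroV = conjunct1[OF R2]
    and addV = conjunct1[OF R3, rule_format] and smulV = conjunct1[OF R4, rule_format]
    and ip_add = conjunct1[OF R5, rule_format] and ip_smul = conjunct1[OF R6, rule_format]
    and ip_sym = conjunct1[OF R7, rule_format] and ip_nonneg = conjunct1[OF R8, rule_format]
    and complete = conjunct1[OF R10, rule_format] and kfunV = conjunct1[OF R11, rule_format]
    and repr = R12[rule_format]
  have Brepr: "B f (kfun r K y c) = (\<Sum>i<r. inner (c i) (f y i))" if "f \<in> V" "y \<in> Ell" for f y c
    unfolding B_def repr[OF that]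
    by (simp add: linear_sum[OF bounded_linear.linear[OF bounded_linear_q0]] q0_qcnj_qmul)
  interpret real_form_space V ?add ?scl B
  proof
    show "?add f g \<in> V" if "f \<in> V" "g \<in> V" for f g using addV that .
    show "?scl t f \<in> V" if "f \<in> V" for f t
      using smulV[OF that, of "(complex_of_real t, 0)"] by (simp add: qmul_of_real)
    show "B (?add f g) h = B f h + B g h" if "f \<in> V" "g \<in> V" "h \<in> V" for f g h
      using ip_add[OF that] by (simp add: B_def q0_def)
    show "B (?scl t f) h = t * B f h" if "f \<in> V" "h \<in> V" for f h t
      using ip_smul[OF that, of "(complex_of_real t, 0)"] by (simp add: B_def qmul_of_real q0_def)
    show "B f g = B g f" if "f \<in> V" "g \<in> V" for f g
      using ip_sym[OF that] by (simp add: B_def q0_def qcnj_def)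
    show "0 \<le> B f f" if "f \<in> V" for f
      using ip_nonneg[OF that] by (simp add: B_def qnonneg_real_def)
  qed
  have lin: "lin f t g = (\<lambda>x i. f x i + t *\<^sub>R g x i)" for f t g by (simp add: lin_def)
  have diff: "lin f (-1) g = (\<lambda>x i. f x i - g x i)" for f g by (simp add: lin)
  have norm_eq: "ipnorm ip f = sqrt (B f f)" for f by (simp add: ipnorm_def B_def)
  define comb where "comb N d = (\<lambda>x i. \<Sum>a<N. kfun r K (fst (d a)) (snd (d a)) x i)"
    for N and d :: "nat \<Rightarrow> quat \<times> (nat \<Rightarrow> quat)"
  define val where "val N d = (\<Sum>a<N. \<Sum>i<r. inner (snd (d a) i) (F (fst (d a)) i))"
    for N and d :: "nat \<Rightarrow> quat \<times> (nat \<Rightarrow> quat)"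
  \<comment> \<open>A relation rather than a function: different families may give the same
    combination, and equality of their values is not established beforehand.\<close>
  define \<Gamma> where "\<Gamma> = {(comb N d, val N d) | N d. \<forall>a<N. fst (d a) \<in> Ell}"
  have combV: "comb N d \<in> V" if "\<forall>a<N. fst (d a) \<in> Ell" for N d
    using that
  proof (induction N)
    case 0
    show ?case using zeroV by (simp add: comb_def)
  next
    case (Suc N)
    then show ?case
      using addV[of "comb N d" "kfun r K (fst (d N)) (snd (d N))"] kfunV by (simp add: comb_def)
  qed
  have B_comb: "B f (comb N d) = (\<Sum>a<N. \<Sum>i<r. inner (snd (d a) i) (f (fst (d a)) i))"
    if f: "f \<in> V" and d: "\<forall>a<N. fst (d a) \<in> Ell" for f N d
    using d
  proof (induction N)
    case 0
    have "B (?scl 0 (\<lambda>x i. 0)) f = 0 * B (\<lambda>x i. 0) f" by (rule B_scl[OF zeroV f])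
    then show ?case using B_sym[OF f zeroV] by (simp add: comb_def)
  next
    case (Suc N)
    let ?k = "kfun r K (fst (d N)) (snd (d N))"
    have V: "comb N d \<in> V" "?k \<in> V" using Suc.prems by (auto intro: combV kfunV)
    have "comb (Suc N) d = ?add (comb N d) ?k" by (simp add: comb_def)
    then have "B f (comb (Suc N) d) = B f (comb N d) + B f ?k"
      using B_add[OF V f] B_sym[OF f addV[OF V]] B_sym[OF f V(1)] B_sym[OF f V(2)] by simp
    then show ?case using Suc Brepr[OF f, of "fst (d N)"] by simp
  qed
  obtain f where f: "f \<in> V" "B f f \<le> \<kappa>" "\<And>g \<phi>. (g, \<phi>) \<in> \<Gamma> \<Longrightarrow> B f g = \<phi>"
  proof (rule riesz_graph[of \<Gamma> \<kappa>])
    fix G :: "nat \<Rightarrow> quat \<Rightarrow> nat \<Rightarrow> quat"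
    assume G: "\<And>n. G n \<in> V"
      and C: "\<And>e. e > 0 \<Longrightarrow> \<exists>M. \<forall>m\<ge>M. \<forall>n\<ge>M. sqrt (B (lin (G m) (-1) (G n)) (lin (G m) (-1) (G n))) < e"
    show "\<exists>f\<in>V. (\<lambda>n. sqrt (B (lin (G n) (-1) f) (lin (G n) (-1) f))) \<longlonglongrightarrow> 0"
      unfolding diff by (rule complete[OF G, unfolded norm_eq]) (rule C[unfolded diff])
  next
    show "g \<in> V" if "(g, \<phi>) \<in> \<Gamma>" for g \<phi> using that combV by (auto simp: \<Gamma>_def)
    have "(comb 0 (\<lambda>_. undefined), val 0 (\<lambda>_. undefined)) \<in> \<Gamma>" unfolding \<Gamma>_def by blast
    then show "\<Gamma> \<noteq> {}" by blast
    show "\<kappa> \<ge> 0" by (rule \<kappa>)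
  next
    fix g \<phi> h \<psi> t assume "(g, \<phi>) \<in> \<Gamma>" "(h, \<psi>) \<in> \<Gamma>"
    then obtain N d M e where g: "g = comb N d" "\<phi> = val N d" "\<forall>a<N. fst (d a) \<in> Ell"
      and h: "h = comb M e" "\<psi> = val M e" "\<forall>a<M. fst (e a) \<in> Ell"
      by (auto simp: \<Gamma>_def)
    define e' where "e' a = (fst (e a), \<lambda>i. t *\<^sub>R snd (e a) i)" for a
    \<comment> \<open>The two families are concatenated, with the scalar t absorbed into the
      coefficients of the second.\<close>
    define c where "c a = (if a < N then d a else e' (a - N))" for a
    have "comb (N + M) c = lin g t h"
    proof (intro ext)
      fix x i
      have "comb (N + M) c x i = comb N d x i + comb M e' x i"
        unfolding comb_def c_def by (rule sum_concat[of "\<lambda>z. kfun r K (fst z) (snd z) x i"])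
      also have "comb M e' x i = t *\<^sub>R comb M e x i"
        by (cases "x \<in> Ell \<and> i < r")
          (auto simp: comb_def e'_def kfun_def qmul_lin.scaleR_right scaleR_sum_right)
      finally show "comb (N + M) c x i = lin g t h x i" by (simp add: lin g h)
    qed
    moreover have "val (N + M) c = \<phi> + t * \<psi>"
    proof -
      have "val (N + M) c = val N d + val M e'"
        unfolding val_def c_def by (rule sum_concat[of "\<lambda>z. \<Sum>i<r. inner (snd z i) (F (fst z) i)"])
      also have "val M e' = t * val M e" by (simp add: val_def e'_def sum_distrib_left)
      finally show ?thesis by (simp add: g h)
    qed
    moreover have "\<forall>a<N + M. fst (c a) \<in> Ell" using g(3) h(3) by (auto simp: c_def e'_def)
    then have "(comb (N + M) c, val (N + M) c) \<in> \<Gamma>" unfolding \<Gamma>_def by blast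
    ultimately show "(lin g t h, \<phi> + t * \<psi>) \<in> \<Gamma>" by simp
  next
    fix g \<phi> assume "(g, \<phi>) \<in> \<Gamma>"
    then obtain N d where g: "g = comb N d" "\<phi> = val N d" "\<forall>a<N. fst (d a) \<in> Ell"
      by (auto simp: \<Gamma>_def)
    \<comment> \<open>The reproducing property applied to \<open>g\<close> itself turns its squared
      norm into the quadratic form of the kernel.\<close>
    have "B g g = (\<Sum>a<N. \<Sum>i<r. inner (snd (d a) i) (g (fst (d a)) i))"
      using B_comb[OF combV[OF g(3)] g(3)] by (simp add: g(1))
    also have "\<dots> = kform r K N (\<lambda>a. fst (d a)) (\<lambda>a. snd (d a))"
      unfolding kform_def
    proof (rule sum.cong[OF refl])
      fix a assume a: "a \<in> {..<N}"
      have "(\<Sum>i<r. inner (snd (d a) i) (g (fst (d a)) i))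
          = (\<Sum>i<r. \<Sum>b<N. \<Sum>j<r. inner (snd (d a) i) (qmul (K (fst (d a)) (fst (d b)) i j) (snd (d b) j)))"
        using a g(3) by (intro sum.cong refl) (simp add: g(1) comb_def kfun_def inner_sum_right)
      then show "(\<Sum>i<r. inner (snd (d a) i) (g (fst (d a)) i))
          = (\<Sum>b<N. \<Sum>i<r. \<Sum>j<r. inner (snd (d a) i) (qmul (K (fst (d a)) (fst (d b)) i j) (snd (d b) j)))"
        by (subst sum.swap) simp
    qed
    finally show "\<phi>\<^sup>2 \<le> \<kappa> * B g g"
      using bound[of N "\<lambda>a. fst (d a)" "\<lambda>a. snd (d a)"] g(3) by (simp add: g(2) val_def)
  next
    fix f assume "f \<in> V" "B f f \<le> \<kappa>" "\<And>g \<phi>. (g, \<phi>) \<in> \<Gamma> \<Longrightarrow> B f g = \<phi>"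
    then show thesis by (rule that)
  qed
  \<comment> \<open>A family with one point and arbitrary coefficients recovers the value at that
    point.\<close>
  have eval: "(\<Sum>i<r. inner (c i) (f y i)) = (\<Sum>i<r. inner (c i) (F y i))" if y: "y \<in> Ell" for y c
  proof -
    have "(comb 1 (\<lambda>_. (y, c)), val 1 (\<lambda>_. (y, c))) \<in> \<Gamma>" unfolding \<Gamma>_def
      using y by (intro CollectI exI[of _ 1] exI[of _ "\<lambda>_. (y, c)"]) simp
    from f(3)[OF this] show ?thesis using B_comb[OF f(1), of 1 "\<lambda>_. (y, c)"] y by (simp add: val_def)
  qed
  have "f = F"
  proof (intro ext)
    fix y i
    show "f y i = F y i"
    proof (cases "y \<in> Ell \<and> i < r")
      case False
      then show ?thesis using F0[of y i] zero[OF f(1), of y i] by auto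
    next
      case True
      have delta: "(\<Sum>j<r. inner (if j = i then v else 0) (h j)) = inner v (h i)"
        for v and h :: "nat \<Rightarrow> quat"
      proof -
        have "(\<Sum>j<r. inner (if j = i then v else 0) (h j)) = (\<Sum>j<r. if j = i then inner v (h j) else 0)"
          by (intro sum.cong) auto
        then show ?thesis using True by simp
      qed
      have "inner v (f y i) = inner v (F y i)" for v
        using eval[of y "\<lambda>j. if j = i then v else 0"] True unfolding delta by blast
      then show ?thesis using vector_eq_ldot by blast
    qed
  qed
  then show ?thesis using f B_nonneg[OF f(1)] by (simp add: norm_eq)
qed

text \<open>Summability accompanies the estimate because \<open>R0Su\<close> is defined by an
  infinite sum, which is meaningful only where it converges. The estimate is made in every model of
  H(S).\<close>

theorem mainTheorem17:
  fixes r s :: nat and Sc :: "nat \<Rightarrow> nat \<Rightarrow> nat \<Rightarrow> quat" and u :: "nat \<Rightarrow> quat"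
  assumes "schur_multiplier r s Sc"
  shows "(\<forall>x\<in>Ell. \<forall>i<r. summable (\<lambda>n. qmul (Ppoly n x) (\<Sum>k<s. qmul (Sc (Suc n) i k) (u k)))) \<and>
         (\<forall>V ip. is_RKHS r (KS s Sc) V ip \<longrightarrow>
            R0Su r s Sc u \<in> V \<and>
            (ipnorm ip (R0Su r s Sc u))\<^sup>2
              \<le> (\<Sum>k<s. (norm (u k))\<^sup>2) - (\<Sum>i<r. (norm (\<Sum>k<s. qmul (Sval Sc 0 i k) (u k)))\<^sup>2))"
proof (intro conjI allI impI ballI)
  fix x i assume "x \<in> Ell" "i < r"
  then show "summable (\<lambda>n. qmul (Ppoly n x) (\<Sum>k<s. qmul (Sc (Suc n) i k) (u k)))"
    using R0Su_summable[OF assms, of x i u] by (simp add: Scol_def)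
next
  fix V ip assume RK: "is_RKHS r (KS s Sc) V ip"
  have *: "R0Su r s Sc u \<in> V \<and> (ipnorm ip (R0Su r s Sc u))\<^sup>2 \<le> defect r s Sc u"
  proof (rule RKHS_membership[OF RK defect_nonneg[OF assms]])
    show "R0Su r s Sc u x i = 0" if "x \<notin> Ell \<or> r \<le> i" for x i
      using that by (auto simp: R0Su_def)
  qed (rule R0Su_functional_bound[OF assms])
  then show "R0Su r s Sc u \<in> V" by simp
  show "(ipnorm ip (R0Su r s Sc u))\<^sup>2
      \<le> (\<Sum>k<s. (norm (u k))\<^sup>2) - (\<Sum>i<r. (norm (\<Sum>k<s. qmul (Sval Sc 0 i k) (u k)))\<^sup>2)"
    using * by (simp add: defect_def Scol_def Sval_zero)
qed

end
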